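(* Let $\mathbb{F}$ be a field and $n\in\mathbb{N}$. If $\mathcal{X},\mathcal{Y}\in\mathbf{Top}^{\mathbf{R}_*}$, then $$d_I\Big(H_n\big(\mathbf{ln}(\mathcal{X}\times\mathcal{Y});\mathbb{F}\big),\,H_n\big(\mathbf{ln}(\mathcal{X}\otimes_{\mathbf{g}}\mathcal{Y});\mathbb{F}\big)\Big)\le\ln(2).$$
   Context: $\mathbf{R}$ and $\mathbf{R}_*$ are the poset categories of $\mathbb{R}$ and of the set $\mathbb{R}_*$ of positive reals; $\mathbf{C}^{\mathbf{I}}$ denotes the category of functors $\mathbf{I}\to\mathbf{C}$. $\mathbf{ln}:\mathbf{Top}^{\mathbf{R}_*}\to\mathbf{Top}^{\mathbf{R}}$ is the functor $\mathbf{ln}(\mathcal{X})(r)=\mathcal{X}(e^r)$, $\mathbf{ln}(\mathcal{X})(r\le r')=\mathcal{X}(e^r\le e^{r'})$. For $\mathcal{Z}\in\mathbf{Top}^{\mathbf{R}}$, $H_n(\mathcal{Z};\mathbb{F})$ is the functor $r\mapsto H_n(Z_r;\mathbb{F})$ (singular homology) from $\mathbf{R}$ to $\mathbb{F}$-vector spaces. Categorical product: $(\mathcal{X}\times\mathcal{Y})_r=X_r\times Y_r$ with product maps. Homotopy colimit: for $D:\mathbf{I}\to\mathbf{Top}$ with $\mathbf{I}$ small, $$\mathsf{hocolim}(D)=\mathsf{coeq}\Big[\coprod_{i\to j}D(i)\times\mathcal{B}(j\downarrow\mathbf{I})^{op}\rightrightarrows\coprod_iD(i)\times\mathcal{B}(i\downarrow\mathbf{I})^{op}\Big],$$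 where $(i\downarrow\mathbf{I})$ is the undercategory, $\mathcal{B}$ is the classifying space, one map is $D(i\to j)\times\mathrm{id}$ into the $j$ summand and the other is $\mathrm{id}\times$ (the map induced by precomposition with $i\to j$) into the $i$ summand. Generalized tensor product: for $r\in\mathbb{R}_*$ let $\triangle_r$ be the poset category of $\{(i,j)\in\mathbb{R}_*^2:i+j\le r\}$ with the product order, and $\mathcal{X}\boxtimes\mathcal{Y}:\mathbf{R}_*^2\to\mathbf{Top}$ the functor $(i,j)\mapsto X_i\times Y_j$ with product maps; then $(\mathcal{X}\otimes_{\mathbf{g}}\mathcal{Y})_r=\mathsf{hocolim}(\mathcal{X}\boxtimes\mathcal{Y}|_{\triangle_r})$, with structure maps for $r\le r'$ induced by the inclusion $\triangle_r\subset\triangle_{r'}$. Interleaving distance: for $\mathcal{M}\in\mathbf{C}^{\mathbf{R}}$ and $\delta\ge0$, $T_\delta(\mathcal{M})(r)=\mathcal{M}(r+\delta)$ (and similarly on morphisms), and $T_\delta^{\mathcal{M}}:\mathcal{M}\to T_\delta(\mathcal{M})$ has components $\mathcal{M}(r\le r+\delta)$. A $\delta$-interleaving between $\mathcal{M}$ and $\mathcal{N}$ is a pair of morphisms $\varphi:\mathcal{M}\to T_\delta(\mathcal{N})$, $\psi:\mathcal{N}\to T_\delta(\mathcal{M})$ with $T_\delta(\varphi)\circ\psi=T^{\mathcal{N}}_{2\delta}$ and $T_\delta(\psi)\circ\varphi=T^{\mathcal{M}}_{2\delta}$. $d_I(\mathcal{M},\mathcal{N})$ is the infimum of all $\delta$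 for which a $\delta$-interleaving exists ($\infty$ if none). *)

theory Defs
  imports
    "HOL-Homology.Homology"
    "HOL-Analysis.Analysis"
    "HOL-Algebra.Module"
    "HOL-Library.Poly_Mapping"
    "HOL-Library.Extended_Real"
begin

section \<open>Small categories\<close>

text \<open>\<open>Comp C g f\<close> is the composite \<open>g \<circ> f\<close>. All categories below are built from poset
  categories, so no axioms are recorded.\<close>

record ('o, 'm) small_cat =
  Obj :: "'o set"
  Arr :: "'m set"
  Src :: "'m \<Rightarrow> 'o"
  Tgt :: "'m \<Rightarrow> 'o"
  Idt :: "'o \<Rightarrow> 'm"
  Comp :: "'m \<Rightarrow> 'm \<Rightarrow> 'm"

definition poset_cat :: "'o set \<Rightarrow> ('o \<Rightarrow> 'o \<Rightarrow> bool) \<Rightarrow> ('o, 'o \<times> 'o) small_cat" where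
  "poset_cat P lq =
    \<lparr>Obj = P, Arr = {(a, b). a \<in> P \<and> b \<in> P \<and> lq a b}, Src = fst, Tgt = snd,
     Idt = (\<lambda>a. (a, a)), Comp = (\<lambda>g f. (fst f, snd g))\<rparr>"

definition op_cat :: "('o, 'm) small_cat \<Rightarrow> ('o, 'm) small_cat" where
  "op_cat C =
    \<lparr>Obj = Obj C, Arr = Arr C, Src = Tgt C, Tgt = Src C, Idt = Idt C,
     Comp = (\<lambda>g f. Comp C f g)\<rparr>"

text \<open>The undercategory \<open>(i \<down> C)\<close>: its objects are the arrows \<open>f\<close> out of \<open>i\<close>, and an arrow
  from \<open>f\<close> to \<open>g\<close> is a triple \<open>(f, h, g)\<close> with \<open>h \<circ> f = g\<close>.\<close>

definition under_cat :: "('o, 'm) small_cat \<Rightarrow> 'o \<Rightarrow> ('m, 'm \<times> 'm \<times> 'm) small_cat" where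
  "under_cat C i =
    \<lparr>Obj = {f \<in> Arr C. Src C f = i},
     Arr = {(f, h, g). f \<in> Arr C \<and> Src C f = i \<and> g \<in> Arr C \<and> Src C g = i \<and> h \<in> Arr C \<and>
                       Src C h = Tgt C f \<and> Tgt C h = Tgt C g \<and> Comp C h f = g},
     Src = (\<lambda>(f, h, g). f),
     Tgt = (\<lambda>(f, h, g). g),
     Idt = (\<lambda>f. (f, Idt C (Tgt C f), f)),
     Comp = (\<lambda>(g', k, l) (f, h, g). (f, Comp C k h, l))\<rparr>"

text \<open>The action on arrows of the functor \<open>(j \<down> C) \<rightarrow> (i \<down> C)\<close> given by precomposition with
  \<open>u : i \<rightarrow> j\<close>.\<close>

definition under_precomp :: "('o, 'm) small_cat \<Rightarrow> 'm \<Rightarrow> 'm \<times> 'm \<times> 'm \<Rightarrow> 'm \<times> 'm \<times> 'm" where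
  "under_precomp C u = (\<lambda>(f, h, g). (Comp C f u, h, Comp C g u))"

text \<open>A diagram \<open>D\<close> sends an object \<open>i\<close> to \<open>Ob D i\<close> and an arrow \<open>u\<close> to \<open>Mp D u\<close>. For a
  poset category the arrow \<open>i \<le> j\<close> is the pair \<open>(i, j)\<close>. With \<open>'s = 'a topology\<close> the diagram
  takes values in spaces, with \<open>'s = ('f, 'a) module\<close> in vector spaces.\<close>

record ('o, 'm, 's, 'a) diagram =
  Ob :: "'o \<Rightarrow> 's"
  Mp :: "'m \<Rightarrow> 'a \<Rightarrow> 'a"

type_synonym ('o, 'm, 'a) top_diagram = "('o, 'm, 'a topology, 'a) diagram"

definition top_functor :: "('o, 'm) small_cat \<Rightarrow> ('o, 'm, 'a) top_diagram \<Rightarrow> bool" where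
  "top_functor C D \<longleftrightarrow>
    (\<forall>u\<in>Arr C. continuous_map (Ob D (Src C u)) (Ob D (Tgt C u)) (Mp D u)) \<and>
    (\<forall>i\<in>Obj C. \<forall>x\<in>topspace (Ob D i). Mp D (Idt C i) x = x) \<and>
    (\<forall>f\<in>Arr C. \<forall>g\<in>Arr C. Src C g = Tgt C f \<longrightarrow>
       (\<forall>x\<in>topspace (Ob D (Src C f)). Mp D (Comp C g f) x = Mp D g (Mp D f x)))"


section \<open>Gluing and coequalizers of spaces\<close>

definition eq_closure :: "('a \<times> 'a) set \<Rightarrow> ('a \<times> 'a) set" where
  "eq_closure r = (r \<union> r\<inverse>)\<^sup>*"

text \<open>The quotient of \<open>X\<close> by the equivalence relation generated by \<open>r\<close>; its points are the
  equivalence classes.\<close>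

definition glue :: "'a topology \<Rightarrow> ('a \<times> 'a) set \<Rightarrow> 'a set topology" where
  "glue X r = topology (\<lambda>U. U \<subseteq> topspace X // eq_closure r \<and>
     openin X {x \<in> topspace X. eq_closure r `` {x} \<in> U})"

lemma istopology_glue:
  "istopology (\<lambda>U. U \<subseteq> topspace X // eq_closure r \<and>
     openin X {x \<in> topspace X. eq_closure r `` {x} \<in> U})"
proof -
  have "{x \<in> topspace X. eq_closure r `` {x} \<in> S \<inter> T} =
      {x \<in> topspace X. eq_closure r `` {x} \<in> S} \<inter> {x \<in> topspace X. eq_closure r `` {x} \<in> T}" for S T
    by auto
  moreover have "{x \<in> topspace X. eq_closure r `` {x} \<in> \<Union>K} =
      (\<Union>U\<in>K. {x \<in> topspace X. eq_closure r `` {x} \<in> U})" for K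
    by auto
  ultimately show ?thesis
    unfolding istopology_def by auto
qed

lemma openin_glue:
  "openin (glue X r) U \<longleftrightarrow> U \<subseteq> topspace X // eq_closure r \<and>
     openin X {x \<in> topspace X. eq_closure r `` {x} \<in> U}"
  unfolding glue_def by (simp add: topology_inverse' istopology_glue)

text \<open>The map into a quotient by \<open>eq_closure r\<close> induced by a map \<open>f\<close> of representatives
  that respects the identifications.\<close>

definition glue_map :: "('b \<times> 'b) set \<Rightarrow> ('a \<Rightarrow> 'b) \<Rightarrow> 'a set \<Rightarrow> 'b set" where
  "glue_map r f A = eq_closure r `` (f ` A)"

definition coeq_rel :: "'a topology \<Rightarrow> ('a \<Rightarrow> 'b) \<Rightarrow> ('a \<Rightarrow> 'b) \<Rightarrow> ('b \<times> 'b) set" where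
  "coeq_rel X f g = {(f z, g z) | z. z \<in> topspace X}"

definition coequalizer :: "'a topology \<Rightarrow> 'b topology \<Rightarrow> ('a \<Rightarrow> 'b) \<Rightarrow> ('a \<Rightarrow> 'b) \<Rightarrow> 'b set topology"
  where "coequalizer X Y f g = glue Y (coeq_rel X f g)"


section \<open>Classifying spaces\<close>

text \<open>A \<open>k\<close>-simplex of the nerve is a functor from \<open>0 \<le> \<dots> \<le> k\<close> to \<open>C\<close>, given by its values
  \<open>\<sigma> (a, b)\<close> on the arrows \<open>a \<le> b\<close>.\<close>

abbreviation ordinal_arrows :: "nat \<Rightarrow> (nat \<times> nat) set" where
  "ordinal_arrows k \<equiv> {(a, b). a \<le> b \<and> b \<le> k}"

definition nerve :: "('o, 'm) small_cat \<Rightarrow> nat \<Rightarrow> (nat \<times> nat \<Rightarrow> 'm) set" where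
  "nerve C k =
    {\<sigma> \<in> extensional (ordinal_arrows k).
       (\<forall>a b. a \<le> b \<and> b \<le> k \<longrightarrow> \<sigma> (a, b) \<in> Arr C) \<and>
       (\<forall>a\<le>k. \<exists>x\<in>Obj C. \<sigma> (a, a) = Idt C x) \<and>
       (\<forall>a b c. a \<le> b \<and> b \<le> c \<and> c \<le> k \<longrightarrow>
          Src C (\<sigma> (b, c)) = Tgt C (\<sigma> (a, b)) \<and> Comp C (\<sigma> (b, c)) (\<sigma> (a, b)) = \<sigma> (a, c))}"

definition nerve_pullback :: "nat \<Rightarrow> (nat \<Rightarrow> nat) \<Rightarrow> (nat \<times> nat \<Rightarrow> 'm) \<Rightarrow> nat \<times> nat \<Rightarrow> 'm" where
  "nerve_pullback m \<theta> \<sigma> = restrict (\<lambda>(a, b). \<sigma> (\<theta> a, \<theta> b)) (ordinal_arrows m)"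

definition simplex_pushforward :: "nat \<Rightarrow> (nat \<Rightarrow> nat) \<Rightarrow> (nat \<Rightarrow> real) \<Rightarrow> nat \<Rightarrow> real" where
  "simplex_pushforward m \<theta> t = (\<lambda>b. \<Sum>a | a \<le> m \<and> \<theta> a = b. t a)"

type_synonym 'm realization_pt = "(nat \<times> (nat \<times> nat \<Rightarrow> 'm)) \<times> (nat \<Rightarrow> real)"

text \<open>As the sets of simplices are discrete, the coproduct of the spaces \<open>N\<^sub>k C \<times> \<Delta>\<^sup>k\<close> is
  a coproduct of standard simplices indexed by the simplices of the nerve.\<close>

definition realization_sum :: "('o, 'm) small_cat \<Rightarrow> 'm realization_pt topology" where
  "realization_sum C =
    sum_topology (\<lambda>(k, \<sigma>). subtopology (powertop_real UNIV) (standard_simplex k))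
      (SIGMA k : UNIV. nerve C k)"

definition realization_rel :: "('o, 'm) small_cat \<Rightarrow> ('m realization_pt \<times> 'm realization_pt) set"
  where
  "realization_rel C =
    {(((m, nerve_pullback m \<theta> \<sigma>), t), ((k, \<sigma>), simplex_pushforward m \<theta> t)) | m k \<theta> \<sigma> t.
       \<sigma> \<in> nerve C k \<and> t \<in> standard_simplex m \<and> mono_on {..m} \<theta> \<and> \<theta> ` {..m} \<subseteq> {..k}}"

definition classifying_space :: "('o, 'm) small_cat \<Rightarrow> 'm realization_pt set topology" where
  "classifying_space C = glue (realization_sum C) (realization_rel C)"

text \<open>The map of classifying spaces, with target that of \<open>C\<close>, induced by the functor into
  \<open>C\<close> which acts on arrows by \<open>F\<close>.\<close>

definition classifying_map ::
  "('o, 'm) small_cat \<Rightarrow> ('n \<Rightarrow> 'm) \<Rightarrow> 'n realization_pt set \<Rightarrow> 'm realization_pt set" where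
  "classifying_map C F =
    glue_map (realization_rel C)
      (\<lambda>((k, \<sigma>), t). ((k, restrict (F \<circ> \<sigma>) (ordinal_arrows k)), t))"


section \<open>Homotopy colimits\<close>

type_synonym 'm under_pt = "('m \<times> 'm \<times> 'm) realization_pt set"

definition under_space :: "('o, 'm) small_cat \<Rightarrow> 'o \<Rightarrow> 'm under_pt topology" where
  "under_space C i = classifying_space (op_cat (under_cat C i))"

definition hocolim_arrows :: "('o, 'm) small_cat \<Rightarrow> ('o, 'm, 'a) top_diagram \<Rightarrow>
    ('m \<times> 'a \<times> 'm under_pt) topology" where
  "hocolim_arrows C D =
    sum_topology (\<lambda>u. prod_topology (Ob D (Src C u)) (under_space C (Tgt C u))) (Arr C)"

definition hocolim_objects :: "('o, 'm) small_cat \<Rightarrow> ('o, 'm, 'a) top_diagram \<Rightarrow>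
    ('o \<times> 'a \<times> 'm under_pt) topology" where
  "hocolim_objects C D = sum_topology (\<lambda>i. prod_topology (Ob D i) (under_space C i)) (Obj C)"

definition hocolim_push :: "('o, 'm) small_cat \<Rightarrow> ('o, 'm, 'a) top_diagram \<Rightarrow>
    'm \<times> 'a \<times> 'm under_pt \<Rightarrow> 'o \<times> 'a \<times> 'm under_pt" where
  "hocolim_push C D = (\<lambda>(u, x, b). (Tgt C u, Mp D u x, b))"

definition hocolim_pre :: "('o, 'm) small_cat \<Rightarrow>
    'm \<times> 'a \<times> 'm under_pt \<Rightarrow> 'o \<times> 'a \<times> 'm under_pt" where
  "hocolim_pre C = (\<lambda>(u, x, b).
     (Src C u, x, classifying_map (op_cat (under_cat C (Src C u))) (under_precomp C u) b))"

definition hocolim :: "('o, 'm) small_cat \<Rightarrow> ('o, 'm, 'a) top_diagram \<Rightarrow>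
    ('o \<times> 'a \<times> 'm under_pt) set topology" where
  "hocolim C D =
    coequalizer (hocolim_arrows C D) (hocolim_objects C D) (hocolim_push C D) (hocolim_pre C)"

text \<open>The map \<open>hocolim C' (D|C') \<rightarrow> hocolim C D\<close> induced by the inclusion of a subcategory
  \<open>C'\<close> of \<open>C\<close>.\<close>

definition hocolim_incl :: "('o, 'm) small_cat \<Rightarrow> ('o, 'm, 'a) top_diagram \<Rightarrow>
    ('o \<times> 'a \<times> 'm under_pt) set \<Rightarrow> ('o \<times> 'a \<times> 'm under_pt) set" where
  "hocolim_incl C D =
    glue_map (coeq_rel (hocolim_arrows C D) (hocolim_push C D) (hocolim_pre C))
      (\<lambda>(i, x, b). (i, x, classifying_map (op_cat (under_cat C i)) id b))"


section \<open>Persistent spaces\<close>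

type_synonym ('s, 'a) persistent = "(real, real \<times> real, 's, 'a) diagram"
type_synonym 'a persistent_space = "('a topology, 'a) persistent"

abbreviation Rpos_cat :: "(real, real \<times> real) small_cat" where
  "Rpos_cat \<equiv> poset_cat {0<..} (\<le>)"

definition ln_functor :: "('s, 'a) persistent \<Rightarrow> ('s, 'a) persistent" where
  "ln_functor X = \<lparr>Ob = (\<lambda>r. Ob X (exp r)), Mp = (\<lambda>(r, r'). Mp X (exp r, exp r'))\<rparr>"

definition cat_product ::
  "'a persistent_space \<Rightarrow> 'b persistent_space \<Rightarrow> ('a \<times> 'b) persistent_space" where
  "cat_product X Y =
    \<lparr>Ob = (\<lambda>r. prod_topology (Ob X r) (Ob Y r)), Mp = (\<lambda>u. map_prod (Mp X u) (Mp Y u))\<rparr>"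

definition triangle_cat ::
  "real \<Rightarrow> (real \<times> real, (real \<times> real) \<times> (real \<times> real)) small_cat" where
  "triangle_cat r =
    poset_cat {(i, j). 0 < i \<and> 0 < j \<and> i + j \<le> r} (\<lambda>p q. fst p \<le> fst q \<and> snd p \<le> snd q)"

definition box_product :: "'a persistent_space \<Rightarrow> 'b persistent_space \<Rightarrow>
    (real \<times> real, (real \<times> real) \<times> (real \<times> real), 'a \<times> 'b) top_diagram" where
  "box_product X Y =
    \<lparr>Ob = (\<lambda>(i, j). prod_topology (Ob X i) (Ob Y j)),
     Mp = (\<lambda>((i, j), (i', j')). map_prod (Mp X (i, i')) (Mp Y (j, j')))\<rparr>"

type_synonym ('a, 'b) tensor_pt =
  "((real \<times> real) \<times> ('a \<times> 'b) \<times> ((real \<times> real) \<times> (real \<times> real)) under_pt) set"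

definition gen_tensor ::
  "'a persistent_space \<Rightarrow> 'b persistent_space \<Rightarrow> ('a, 'b) tensor_pt persistent_space" where
  "gen_tensor X Y =
    \<lparr>Ob = (\<lambda>r. hocolim (triangle_cat r) (box_product X Y)),
     Mp = (\<lambda>(r, r'). hocolim_incl (triangle_cat r') (box_product X Y))\<rparr>"


section \<open>Singular homology with coefficients in a field\<close>

type_synonym ('a, 'f) fchain = "((nat \<Rightarrow> real) \<Rightarrow> 'a) \<Rightarrow>\<^sub>0 'f"

definition fchains :: "nat \<Rightarrow> 'a topology \<Rightarrow> ('a, 'f::field) fchain set" where
  "fchains p X = {c. Poly_Mapping.keys c \<subseteq> singular_simplex_set p X}"

definition fboundary :: "nat \<Rightarrow> ('a, 'f::field) fchain \<Rightarrow> ('a, 'f) fchain" where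
  "fboundary p c =
    (if p = 0 then 0
     else \<Sum>\<sigma>\<in>Poly_Mapping.keys c. \<Sum>k\<le>p.
       Poly_Mapping.single (singular_face p k \<sigma>) ((-1) ^ k * Poly_Mapping.lookup c \<sigma>))"

definition fcycles :: "nat \<Rightarrow> 'a topology \<Rightarrow> ('a, 'f::field) fchain set" where
  "fcycles p X = {c \<in> fchains p X. fboundary p c = 0}"

definition fboundaries :: "nat \<Rightarrow> 'a topology \<Rightarrow> ('a, 'f::field) fchain set" where
  "fboundaries p X = fboundary (Suc p) ` fchains (Suc p) X"

definition fchain_map ::
  "nat \<Rightarrow> ('a \<Rightarrow> 'b) \<Rightarrow> ('a, 'f::field) fchain \<Rightarrow> ('b, 'f) fchain" where
  "fchain_map p g c =
    (\<Sum>\<sigma>\<in>Poly_Mapping.keys c.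
       Poly_Mapping.single (simplex_map p g \<sigma>) (Poly_Mapping.lookup c \<sigma>))"

text \<open>Homology classes are the cosets of the subspace of boundaries. The ring multiplication and
  the unit of the record \<open>module\<close> have no meaning for a vector space. In \<open>smult\<close> the
  boundaries are added so that the product with the scalar \<open>0\<close> is a full coset as well.\<close>

definition fhomology :: "nat \<Rightarrow> 'a topology \<Rightarrow> ('f::field, ('a, 'f) fchain set) module" where
  "fhomology p X =
    \<lparr>carrier = (\<lambda>c. {c + b | b. b \<in> fboundaries p X}) ` fcycles p X,
     monoid.mult = undefined, monoid.one = undefined,
     zero = fboundaries p X,
     add = (\<lambda>A B. {a + b | a b. a \<in> A \<and> b \<in> B}),
     module.smult = (\<lambda>s A. {Poly_Mapping.map ((*) s) a + b | a b. a \<in> A \<and> b \<in> fboundaries p X})\<rparr>"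

definition fhomology_map ::
  "nat \<Rightarrow> 'b topology \<Rightarrow> ('a \<Rightarrow> 'b) \<Rightarrow> ('a, 'f::field) fchain set \<Rightarrow> ('b, 'f) fchain set" where
  "fhomology_map p Y g A = {fchain_map p g a + b | a b. a \<in> A \<and> b \<in> fboundaries p Y}"

type_synonym ('f, 'v) persistence_module = "(('f, 'v) module, 'v) persistent"

definition persistent_homology ::
  "nat \<Rightarrow> 'a persistent_space \<Rightarrow> 'f::field itself \<Rightarrow>
     ('f, ('a, 'f) fchain set) persistence_module" where
  "persistent_homology n Z F =
    \<lparr>Ob = (\<lambda>r. fhomology n (Ob Z r)), Mp = (\<lambda>(r, r'). fhomology_map n (Ob Z r') (Mp Z (r, r')))\<rparr>"


section \<open>Interleaving distance of persistence modules\<close>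

definition linear_maps :: "('f, 'v) module \<Rightarrow> ('f, 'w) module \<Rightarrow> ('v \<Rightarrow> 'w) set" where
  "linear_maps V W =
    {h \<in> carrier V \<rightarrow> carrier W.
       (\<forall>x\<in>carrier V. \<forall>y\<in>carrier V. h (x \<oplus>\<^bsub>V\<^esub> y) = h x \<oplus>\<^bsub>W\<^esub> h y) \<and>
       (\<forall>s. \<forall>x\<in>carrier V. h (s \<odot>\<^bsub>V\<^esub> x) = s \<odot>\<^bsub>W\<^esub> h x)}"

definition pmod_morphism ::
  "('f, 'v) persistence_module \<Rightarrow> ('f, 'w) persistence_module \<Rightarrow> (real \<Rightarrow> 'v \<Rightarrow> 'w) \<Rightarrow> bool" where
  "pmod_morphism M N \<phi> \<longleftrightarrow>
    (\<forall>r. \<phi> r \<in> linear_maps (Ob M r) (Ob N r)) \<and>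
    (\<forall>r r'. r \<le> r' \<longrightarrow>
      (\<forall>x\<in>carrier (Ob M r). \<phi> r' (Mp M (r, r') x) = Mp N (r, r') (\<phi> r x)))"

definition shift :: "real \<Rightarrow> ('s, 'a) persistent \<Rightarrow> ('s, 'a) persistent" where
  "shift \<delta> M = \<lparr>Ob = (\<lambda>r. Ob M (r + \<delta>)), Mp = (\<lambda>(r, r'). Mp M (r + \<delta>, r' + \<delta>))\<rparr>"

definition shift_unit :: "real \<Rightarrow> ('s, 'a) persistent \<Rightarrow> real \<Rightarrow> 'a \<Rightarrow> 'a" where
  "shift_unit \<delta> M = (\<lambda>r. Mp M (r, r + \<delta>))"

definition interleaving :: "real \<Rightarrow> ('f, 'v) persistence_module \<Rightarrow> ('f, 'w) persistence_module \<Rightarrow>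
    (real \<Rightarrow> 'v \<Rightarrow> 'w) \<Rightarrow> (real \<Rightarrow> 'w \<Rightarrow> 'v) \<Rightarrow> bool" where
  "interleaving \<delta> M N \<phi> \<psi> \<longleftrightarrow>
    pmod_morphism M (shift \<delta> N) \<phi> \<and> pmod_morphism N (shift \<delta> M) \<psi> \<and>
    (\<forall>r. \<forall>y\<in>carrier (Ob N r). \<phi> (r + \<delta>) (\<psi> r y) = shift_unit (2 * \<delta>) N r y) \<and>
    (\<forall>r. \<forall>x\<in>carrier (Ob M r). \<psi> (r + \<delta>) (\<phi> r x) = shift_unit (2 * \<delta>) M r x)"

definition interleaving_distance ::
  "('f, 'v) persistence_module \<Rightarrow> ('f, 'w) persistence_module \<Rightarrow> ereal" where
  "interleaving_distance M N = Inf {ereal \<delta> | \<delta>. 0 \<le> \<delta> \<and> (\<exists>\<phi> \<psi>. interleaving \<delta> M N \<phi> \<psi>)}"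

end

theory Submission
  imports Defs
begin

text \<open>The interleaving exists already at the level of spaces, up to homotopy. For \<open>s > 0\<close> the point
  \<open>(s, s)\<close> lies in the triangle of size \<open>2 s\<close>, so \<open>X s \<times> Y s\<close> maps to the homotopy colimit over
  that triangle as the vertex at \<open>(s, s)\<close> (\<open>hocolim_vertex\<close>). Conversely all \<open>(i, j)\<close> in the
  triangle of size \<open>s\<close> satisfy \<open>i, j \<le> s\<close>, so the structure maps of \<open>X\<close> and \<open>Y\<close> collapse the
  homotopy colimit over this triangle to \<open>X (2 s) \<times> Y (2 s)\<close> (\<open>hocolim_collapse\<close>). Both maps multiply
  the parameter by \<open>2\<close>, which in the logarithmic scale is a shift by \<open>ln 2\<close>.

  Vertex followed by collapse is a structure map, and the collapse is natural. The naturality of the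
  vertex map and the other composite hold only up to homotopy, and both come from one fact
  (\<open>hocolim_incl_homotopic_collapse\<close>): if \<open>P \<subseteq> Q\<close> and \<open>j \<in> Q\<close> is an upper bound of \<open>P\<close>, then the
  map from the homotopy colimit over \<open>P\<close> to the one over \<open>Q\<close> is homotopic to the collapse to \<open>D j\<close>
  followed by the vertex at \<open>j\<close>. Indeed a point of the classifying space of the opposite of \<open>(i \<down> P)\<close>
  is a descending sequence of elements of \<open>P\<close> above \<open>i\<close> with barycentric coordinates. Such
  a sequence can be extended by \<open>j\<close> at its upper end, and moving all the weight linearly to the new
  vertex deforms the inclusion into a constant map (\<open>cone_homotopy\<close>). The deformation is compatible
  with the identifications in the classifying space and in the homotopy colimit, and it descends to
  these quotients because the product of a quotient map with the compact interval is a quotient map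
  (\<open>glue_homotopy\<close>).

  It remains to see that homotopic maps agree in homology with coefficients in a field
  (\<open>fhomology_map_homotopic\<close>). The model prism \<open>[0, 1] \<times> \<Delta>\<close> over a simplex \<open>\<Delta>\<close> is contractible,
  so its integral cycles of positive degree bound. This yields, one degree at a time, an integral
  chain homotopy which is natural in the space (\<open>prism_sequence\<close>). As it is given on every single
  simplex, it extends linearly to chains over the field.\<close>

section \<open>Linear extension of maps between free vector spaces\<close>

text \<open>The linear map on the free vector space over \<open>'a\<close> with prescribed values on the basis. Boundaries,
  induced chain maps and chain homotopies all have this form, so that identities between them
  need to be checked on single simplices only.\<close>

definition lin_extend :: "('a \<Rightarrow> 'b \<Rightarrow>\<^sub>0 'f) \<Rightarrow> ('a \<Rightarrow>\<^sub>0 'f::field) \<Rightarrow> 'b \<Rightarrow>\<^sub>0 'f" where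
  "lin_extend f c =
    (\<Sum>x\<in>Poly_Mapping.keys c. Poly_Mapping.map ((*) (Poly_Mapping.lookup c x)) (f x))"

lemma lookup_scale [simp]:
  "Poly_Mapping.lookup (Poly_Mapping.map ((*) s) c) k = s * Poly_Mapping.lookup c k"
  for s :: "'f::field"
  by (simp add: map.rep_eq when_def)

lemma scale_zero [simp]: "Poly_Mapping.map ((*) s) 0 = 0" for s :: "'f::field"
  by (rule poly_mapping_eqI) simp

lemma scale_one [simp]: "Poly_Mapping.map ((*) 1) c = c" for c :: "'a \<Rightarrow>\<^sub>0 'f::field"
  by (rule poly_mapping_eqI) simp

lemma scale_add: "Poly_Mapping.map ((*) s) (a + b) = Poly_Mapping.map ((*) s) a + Poly_Mapping.map ((*) s) b"
  for s :: "'f::field"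
  by (rule poly_mapping_eqI) (simp add: lookup_add distrib_left)

lemma lookup_lin_extend:
  assumes "finite A" "Poly_Mapping.keys c \<subseteq> A"
  shows "Poly_Mapping.lookup (lin_extend f c) y
    = (\<Sum>x\<in>A. Poly_Mapping.lookup c x * Poly_Mapping.lookup (f x) y)"
  unfolding lin_extend_def lookup_sum lookup_scale
  by (rule sum.mono_neutral_left) (use assms in \<open>auto simp: in_keys_iff\<close>)

lemma lin_extend_add: "lin_extend f (a + b) = lin_extend f a + lin_extend f b"
proof (rule poly_mapping_eqI)
  fix y
  let ?A = "Poly_Mapping.keys a \<union> Poly_Mapping.keys b"
  have "Poly_Mapping.keys (a + b) \<subseteq> ?A" by (rule keys_add)
  then show "Poly_Mapping.lookup (lin_extend f (a + b)) y
      = Poly_Mapping.lookup (lin_extend f a + lin_extend f b) y"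
    by (simp add: lookup_lin_extend[of ?A] lookup_add distrib_right sum.distrib)
qed

lemma lin_extend_0 [simp]: "lin_extend f 0 = 0"
  by (simp add: lin_extend_def)

lemma lin_extend_scale:
  "lin_extend f (Poly_Mapping.map ((*) s) c) = Poly_Mapping.map ((*) s) (lin_extend f c)"
proof (rule poly_mapping_eqI)
  fix y
  have "Poly_Mapping.keys (Poly_Mapping.map ((*) s) c) \<subseteq> Poly_Mapping.keys c"
    by (auto simp: in_keys_iff)
  then show "Poly_Mapping.lookup (lin_extend f (Poly_Mapping.map ((*) s) c)) y
      = Poly_Mapping.lookup (Poly_Mapping.map ((*) s) (lin_extend f c)) y"
    by (simp add: lookup_lin_extend[of "Poly_Mapping.keys c"] sum_distrib_left mult.assoc)
qed

lemma lin_extend_minus: "lin_extend f (- c) = - lin_extend f c"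
  by (metis add_eq_0_iff lin_extend_0 lin_extend_add)

lemma lin_extend_diff: "lin_extend f (a - b) = lin_extend f a - lin_extend f b"
  by (metis diff_conv_add_uminus lin_extend_add lin_extend_minus)

lemma lin_extend_sum: "lin_extend f (\<Sum>i\<in>I. c i) = (\<Sum>i\<in>I. lin_extend f (c i))"
  by (induction I rule: infinite_finite_induct) (simp_all add: lin_extend_add)

lemma lin_extend_single [simp]:
  "lin_extend f (Poly_Mapping.single x s) = Poly_Mapping.map ((*) s) (f x)"
  by (rule poly_mapping_eqI) (simp add: lookup_lin_extend[of "{x}"])

lemma lin_extend_lin_extend:
  "lin_extend g (lin_extend f c) = lin_extend (\<lambda>x. lin_extend g (f x)) c"
  by (simp add: lin_extend_def[of f] lin_extend_def[of "\<lambda>x. lin_extend g (f x)"]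
      lin_extend_sum lin_extend_scale)

lemma lin_extend_cong:
  "(\<And>x. x \<in> Poly_Mapping.keys c \<Longrightarrow> f x = g x) \<Longrightarrow> lin_extend f c = lin_extend g c"
  unfolding lin_extend_def by (rule sum.cong) auto

lemma keys_lin_extend:
  "Poly_Mapping.keys (lin_extend f c) \<subseteq> (\<Union>x\<in>Poly_Mapping.keys c. Poly_Mapping.keys (f x))"
proof
  fix y assume "y \<in> Poly_Mapping.keys (lin_extend f c)"
  then have "(\<Sum>x\<in>Poly_Mapping.keys c. Poly_Mapping.lookup c x * Poly_Mapping.lookup (f x) y) \<noteq> 0"
    by (simp add: in_keys_iff lookup_lin_extend[of "Poly_Mapping.keys c"])
  then obtain x where "x \<in> Poly_Mapping.keys c" "Poly_Mapping.lookup (f x) y \<noteq> 0"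
    by (metis (mono_tags, lifting) mult_zero_right sum.neutral)
  then show "y \<in> (\<Union>x\<in>Poly_Mapping.keys c. Poly_Mapping.keys (f x))"
    by (auto simp: in_keys_iff)
qed

lemma lin_extend_pointwise_diff:
  "lin_extend (\<lambda>x. f x - g x) c = lin_extend f c - lin_extend g c"
  by (rule poly_mapping_eqI)
    (simp add: lookup_lin_extend[of "Poly_Mapping.keys c"] lookup_minus right_diff_distrib
      sum_subtractf)

lemma scale_sum:
  "Poly_Mapping.map ((*) s) (\<Sum>k\<in>I. h k) = (\<Sum>k\<in>I. Poly_Mapping.map ((*) s) (h k))"
  for s :: "'f::field"
  by (rule poly_mapping_eqI) (simp add: lookup_sum sum_distrib_left)

section \<open>Singular chains over a field\<close>

lemma fboundary_lin_extend:
  "fboundary p = lin_extend (\<lambda>\<sigma>. if p = 0 then 0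
     else \<Sum>k\<le>p. Poly_Mapping.single (singular_face p k \<sigma>) ((-1) ^ k))"
  by (rule ext) (simp add: fboundary_def lin_extend_def scale_sum mult.commute)

lemma fchain_map_lin_extend:
  "fchain_map p g = lin_extend (\<lambda>\<sigma>. Poly_Mapping.single (simplex_map p g \<sigma>) 1)"
  by (rule ext) (simp add: fchain_map_def lin_extend_def)

text \<open>Chains over the field receive a map from the integral ones which commutes with boundaries and
  induced maps. On a single simplex this transports the identities known for integral chains.\<close>

definition coeff_change :: "('a \<Rightarrow>\<^sub>0 int) \<Rightarrow> 'a \<Rightarrow>\<^sub>0 'f::field" where
  "coeff_change = Poly_Mapping.map of_int"

lemma lookup_coeff_change [simp]:
  "Poly_Mapping.lookup (coeff_change c) x = of_int (Poly_Mapping.lookup c x)"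
  by (simp add: coeff_change_def map.rep_eq when_def)

lemma coeff_change_0 [simp]: "coeff_change 0 = 0"
  by (rule poly_mapping_eqI) simp

lemma coeff_change_diff: "coeff_change (a - b) = coeff_change a - coeff_change b"
  by (rule poly_mapping_eqI) (simp add: lookup_minus)

lemma coeff_change_frag_of [simp]: "coeff_change (frag_of x) = Poly_Mapping.single x 1"
  by (rule poly_mapping_eqI) (simp add: lookup_single when_def)

lemma coeff_change_frag_cmul:
  "coeff_change (frag_cmul k c) = Poly_Mapping.map ((*) (of_int k)) (coeff_change c)"
  by (rule poly_mapping_eqI) simp

lemma coeff_change_sum: "coeff_change (\<Sum>i\<in>I. c i) = (\<Sum>i\<in>I. coeff_change (c i))"
  by (rule poly_mapping_eqI) (simp add: lookup_sum)

lemma coeff_change_frag_extend: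
  "coeff_change (frag_extend f c) = lin_extend (\<lambda>x. coeff_change (f x)) (coeff_change c)"
  using subset_UNIV
proof (induction c rule: frag_induction)
  case (one x)
  then show ?case by (auto intro: poly_mapping_eqI)
next
  case (diff a b)
  then show ?case by (simp add: frag_extend_diff coeff_change_diff lin_extend_diff)
qed simp

lemma coeff_change_chain_boundary:
  "coeff_change (chain_boundary p c) = fboundary p (coeff_change c)"
  by (auto simp: chain_boundary_def fboundary_lin_extend coeff_change_frag_extend coeff_change_sum
      coeff_change_frag_cmul lin_extend_def[of "\<lambda>_. 0"] poly_mapping_eqI lookup_sum)

lemma coeff_change_chain_map:
  "coeff_change (chain_map p g c) = fchain_map p g (coeff_change c)"
  by (simp add: chain_map_def fchain_map_lin_extend coeff_change_frag_extend)

text \<open>Both sides are linear in \<open>c\<close>, and on a simplex the identity is the integral one.\<close>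

lemma fboundary_fchain_map:
  fixes c :: "('a, 'f::field) fchain"
  assumes "c \<in> fchains p X"
  shows "fboundary p (fchain_map p g c) = fchain_map (p - 1) g (fboundary p c)"
proof -
  have "fboundary p (fchain_map p g (Poly_Mapping.single \<sigma> (1::'f)))
      = fchain_map (p - 1) g (fboundary p (Poly_Mapping.single \<sigma> 1))"
    if "\<sigma> \<in> Poly_Mapping.keys c" for \<sigma>
  proof -
    have "singular_chain p X (frag_of \<sigma>)"
      using assms that by (auto simp: fchains_def singular_chain_of)
    from chain_boundary_chain_map[OF this, of g] show ?thesis
      by (metis One_nat_def coeff_change_chain_boundary coeff_change_chain_map coeff_change_frag_of)
  qed
  then have "lin_extend (\<lambda>\<sigma>. fboundary p (fchain_map p g (Poly_Mapping.single \<sigma> 1))) c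
      = lin_extend (\<lambda>\<sigma>. fchain_map (p - 1) g (fboundary p (Poly_Mapping.single \<sigma> 1))) c"
    by (rule lin_extend_cong)
  then show ?thesis
    by (simp add: fboundary_lin_extend fchain_map_lin_extend lin_extend_lin_extend)
qed

lemma fchain_map_in_fchains:
  assumes "continuous_map X Y g" "c \<in> fchains p X"
  shows "fchain_map p g c \<in> fchains p Y"
  unfolding fchains_def fchain_map_lin_extend
  using assms keys_lin_extend[of "\<lambda>\<sigma>. Poly_Mapping.single (simplex_map p g \<sigma>) 1" c]
  by (fastforce simp: fchains_def dest: singular_simplex_simplex_map)

section \<open>Homology as a functor\<close>

lemma fchains_add: "a \<in> fchains p X \<Longrightarrow> b \<in> fchains p X \<Longrightarrow> a + b \<in> fchains p X"
  using keys_add[of a b] by (auto simp: fchains_def)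

lemma fchains_scale: "c \<in> fchains p X \<Longrightarrow> Poly_Mapping.map ((*) s) c \<in> fchains p X"
  by (auto simp: fchains_def in_keys_iff)

lemma fboundary_add: "fboundary p (a + b) = fboundary p a + fboundary p b"
  by (simp add: fboundary_lin_extend lin_extend_add)

lemma fboundary_scale: "fboundary p (Poly_Mapping.map ((*) s) c) = Poly_Mapping.map ((*) s) (fboundary p c)"
  by (simp add: fboundary_lin_extend lin_extend_scale)

lemma fchain_map_add: "fchain_map p g (a + b) = fchain_map p g a + fchain_map p g b"
  by (simp add: fchain_map_lin_extend lin_extend_add)

lemma fchain_map_scale:
  "fchain_map p g (Poly_Mapping.map ((*) s) c) = Poly_Mapping.map ((*) s) (fchain_map p g c)"
  by (simp add: fchain_map_lin_extend lin_extend_scale)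

lemma fchain_map_compose: "fchain_map p h (fchain_map p g c) = fchain_map p (h \<circ> g) c"
  by (simp add: fchain_map_lin_extend lin_extend_lin_extend simplex_map_compose)

lemma fcycles_fchain_map:
  "continuous_map X Y g \<Longrightarrow> c \<in> fcycles p X \<Longrightarrow> fchain_map p g c \<in> fcycles p Y"
  by (auto simp: fcycles_def fchain_map_in_fchains fboundary_fchain_map)
    (simp add: fchain_map_lin_extend)

lemma fboundaries_0 [simp]: "0 \<in> fboundaries p X"
  unfolding fboundaries_def
  by (rule image_eqI[of _ _ 0]) (simp_all add: fboundary_def fchains_def)

lemma fboundaries_add: "a \<in> fboundaries p X \<Longrightarrow> b \<in> fboundaries p X \<Longrightarrow> a + b \<in> fboundaries p X"
  unfolding fboundaries_def by (auto simp flip: fboundary_add intro: fchains_add)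

lemma fboundaries_scale:
  "b \<in> fboundaries p X \<Longrightarrow> Poly_Mapping.map ((*) s) b \<in> fboundaries p X"
  unfolding fboundaries_def by (auto simp flip: fboundary_scale intro: fchains_scale)

lemma scale_minus_one: "Poly_Mapping.map ((*) (- 1)) c = - c" for c :: "'a \<Rightarrow>\<^sub>0 'f::field"
  by (rule poly_mapping_eqI) simp

lemma fboundaries_minus: "b \<in> fboundaries p X \<Longrightarrow> - b \<in> fboundaries p X"
  using fboundaries_scale[of b p X "- 1"] by (simp add: scale_minus_one)

lemma fboundaries_fchain_map:
  assumes "continuous_map X Y g" "b \<in> fboundaries p X"
  shows "fchain_map p g b \<in> fboundaries p Y"
  using assms(2) fchain_map_in_fchains[OF assms(1)] fboundary_fchain_map[of _ "Suc p" X g]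
  unfolding fboundaries_def by force

definition homology_class :: "nat \<Rightarrow> 'a topology \<Rightarrow> ('a, 'f::field) fchain \<Rightarrow> ('a, 'f) fchain set" where
  "homology_class p X c = {c + b | b. b \<in> fboundaries p X}"

lemma carrier_fhomology: "carrier (fhomology p X) = homology_class p X ` fcycles p X"
  by (simp add: fhomology_def homology_class_def image_def)

lemma homology_class_eqI:
  assumes "a - a' \<in> fboundaries p X"
  shows "homology_class p X a = homology_class p X a'"
proof -
  have "homology_class p X a \<subseteq> homology_class p X a'" if "a - a' \<in> fboundaries p X" for a a'
  proof
    fix x assume "x \<in> homology_class p X a"
    then obtain b where "b \<in> fboundaries p X" "x = a + b" by (auto simp: homology_class_def)
    then show "x \<in> homology_class p X a'"
      unfolding homology_class_def using fboundaries_add[OF that, of b]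
      by (auto intro!: exI[of _ "(a - a') + b"])
  qed
  from this[OF assms] this[of a' a] fboundaries_minus[OF assms] show ?thesis by auto
qed

lemma add_homology_class: "homology_class p X a \<oplus>\<^bsub>fhomology p X\<^esub> homology_class p X b = homology_class p X (a + b)"
proof -
  have "\<exists>b'. a + u + (b + v) = a + b + b' \<and> b' \<in> fboundaries p X"
    if "u \<in> fboundaries p X" "v \<in> fboundaries p X" for u v :: "('a, 'b) fchain"
    using fboundaries_add[OF that] by (intro exI[of _ "u + v"]) (simp add: algebra_simps)
  moreover have "\<exists>x y. a + b + u = x + y \<and> (\<exists>b. x = a + b \<and> b \<in> fboundaries p X) \<and>
      (\<exists>v. y = b + v \<and> v \<in> fboundaries p X)"
    if "u \<in> fboundaries p X" for u :: "('a, 'b) fchain"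
    using that by (intro exI[of _ a] exI[of _ "b + u"]) (auto simp: algebra_simps intro: exI[of _ 0])
  ultimately show ?thesis
    by (auto simp: fhomology_def homology_class_def)
qed

lemma smult_homology_class:
  "s \<odot>\<^bsub>fhomology p X\<^esub> homology_class p X a = homology_class p X (Poly_Mapping.map ((*) s) a)"
proof -
  have "\<exists>b'. Poly_Mapping.map ((*) s) (a + u) + v = Poly_Mapping.map ((*) s) a + b' \<and> b' \<in> fboundaries p X"
    if "u \<in> fboundaries p X" "v \<in> fboundaries p X" for u v
    using fboundaries_add[OF fboundaries_scale[OF that(1)] that(2)]
    by (intro exI[of _ "Poly_Mapping.map ((*) s) u + v"]) (simp add: algebra_simps scale_add)
  moreover have "\<exists>x y. Poly_Mapping.map ((*) s) a + u = Poly_Mapping.map ((*) s) x + y \<and>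
      (\<exists>b. x = a + b \<and> b \<in> fboundaries p X) \<and> y \<in> fboundaries p X"
    if "u \<in> fboundaries p X" for u
    using that by (intro exI[of _ a] exI[of _ u]) (auto intro: exI[of _ 0])
  ultimately show ?thesis
    by (auto simp: fhomology_def homology_class_def)
qed

lemma fhomology_map_homology_class:
  assumes "continuous_map X Y g"
  shows "fhomology_map p Y g (homology_class p X c) = homology_class p Y (fchain_map p g c)"
proof -
  have "\<exists>b'. fchain_map p g (c + u) + v = fchain_map p g c + b' \<and> b' \<in> fboundaries p Y"
    if "u \<in> fboundaries p X" "v \<in> fboundaries p Y" for u v
    using fboundaries_add[OF fboundaries_fchain_map[OF assms that(1)] that(2)]
    by (intro exI[of _ "fchain_map p g u + v"]) (simp add: fchain_map_add algebra_simps)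
  moreover have "\<exists>x y. fchain_map p g c + u = fchain_map p g x + y \<and>
      (\<exists>b. x = c + b \<and> b \<in> fboundaries p X) \<and> y \<in> fboundaries p Y"
    if "u \<in> fboundaries p Y" for u
    using that by (intro exI[of _ c] exI[of _ u]) (auto intro: exI[of _ 0])
  ultimately show ?thesis
    by (auto simp: fhomology_map_def homology_class_def)
qed

lemma fhomology_map_linear:
  assumes "continuous_map X Y g"
  shows "fhomology_map p Y g \<in> linear_maps (fhomology p X) (fhomology p Y)"
  unfolding linear_maps_def carrier_fhomology
  by (auto simp: fhomology_map_homology_class[OF assms] add_homology_class smult_homology_class fchain_map_add
      fchain_map_scale fcycles_fchain_map[OF assms])

lemma fhomology_map_compose:
  assumes "continuous_map X Y g" "continuous_map Y Z h" "A \<in> carrier (fhomology p X)"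
  shows "fhomology_map p Z h (fhomology_map p Y g A) = fhomology_map p Z (h \<circ> g) A"
  using assms(3) unfolding carrier_fhomology
  by (auto simp: fhomology_map_homology_class[OF assms(1)] fhomology_map_homology_class[OF assms(2)]
      fhomology_map_homology_class[OF continuous_map_compose[OF assms(1,2)]] fchain_map_compose)

section \<open>An integral chain homotopy by acyclic models\<close>

text \<open>The standard simplex is contracted linearly to its vertex \<open>0\<close>.\<close>

lemma contractible_prism:
  "contractible_space (prod_topology (top_of_set {0..1::real})
     (subtopology (powertop_real UNIV) (standard_simplex p)))"
  (is "contractible_space (prod_topology ?I ?S)")
proof -
  define v :: "nat \<Rightarrow> real" where "v = (\<lambda>i. if i = 0 then 1 else 0)"
  have v: "v \<in> standard_simplex p" by (simp add: v_def)
  define h where "h = (\<lambda>z::real \<times> (nat \<Rightarrow> real). (\<lambda>i. (1 - fst z) * snd z i + fst z * v i))"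
  have fst: "continuous_map (prod_topology ?I ?S) euclideanreal fst"
    using continuous_map_fst continuous_map_into_fulltopology by blast
  have snd: "continuous_map (prod_topology ?I ?S) euclideanreal (\<lambda>z. snd z i)" for i
    using continuous_map_compose[OF continuous_map_snd
        continuous_map_from_subtopology[OF continuous_map_product_projection[of i UNIV]]]
    by (simp add: o_def)
  have "continuous_map (prod_topology ?I ?S) ?S h"
    unfolding continuous_map_in_subtopology h_def continuous_map_componentwise_UNIV
    using convex_standard_simplex[OF _ v]
    by (auto intro!: continuous_intros fst snd)
  then have "homotopic_with (\<lambda>_. True) ?S ?S id (\<lambda>_. v)"
    unfolding homotopic_with_def by (intro exI[of _ h]) (auto simp: h_def)
  then have "contractible_space ?S" unfolding contractible_space_def by blast
  moreover have "contractible_space ?I"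
    unfolding contractible_space_subtopology_euclideanreal by (rule is_interval_cc)
  ultimately show ?thesis by (simp add: contractible_space_prod_topology)
qed

abbreviation prism :: "nat \<Rightarrow> (real \<times> (nat \<Rightarrow> real)) topology" where
  "prism p \<equiv> prod_topology (top_of_set {0..1}) (subtopology (powertop_real UNIV) (standard_simplex p))"

text \<open>An integral \<open>(p + 1)\<close>-chain \<open>P\<close> on the model prism over the standard \<open>p\<close>-simplex determines a
  homomorphism from the \<open>p\<close>-chains of any space to the \<open>(p + 1)\<close>-chains of its cylinder: transport
  \<open>P\<close> along \<open>id \<times> \<sigma>\<close> for each simplex \<open>\<sigma>\<close>.\<close>

definition prism_operator :: "nat \<Rightarrow> (real \<times> (nat \<Rightarrow> real)) chain \<Rightarrow> 'a chain \<Rightarrow> (real \<times> 'a) chain" where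
  "prism_operator p P = frag_extend (\<lambda>\<sigma>. chain_map (Suc p) (map_prod id \<sigma>) P)"

text \<open>On a simplex \<open>\<sigma>\<close> both sides transport \<open>P\<close> along \<open>id \<times> (g \<circ> \<sigma>)\<close>.\<close>

lemma prism_operator_chain_map:
  assumes "singular_chain (Suc p) (prism p) P"
  shows "chain_map (Suc p) (map_prod id g) (prism_operator p P c) = prism_operator p P (chain_map p g c)"
  using subset_UNIV
proof (induction c rule: frag_induction)
  case (one \<sigma>)
  have "chain_map (Suc p) (map_prod id g \<circ> map_prod id \<sigma>) P
      = chain_map (Suc p) (map_prod id (simplex_map p g \<sigma>)) P"
    by (rule chain_map_eq[OF assms]) (auto simp: simplex_map_def)
  then show ?case
    unfolding prism_operator_def chain_map_of frag_extend_of chain_map_compose o_apply .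
qed (auto simp: prism_operator_def frag_extend_diff chain_map_diff)

lemma singular_chain_prism_operator:
  assumes P: "singular_chain (Suc p) (prism p) P" and c: "singular_chain p X c"
  shows "singular_chain (Suc p) (prod_topology (top_of_set {0..1}) X) (prism_operator p P c)"
  unfolding prism_operator_def
proof (rule singular_chain_extend)
  fix \<sigma> assume "\<sigma> \<in> Poly_Mapping.keys c"
  then have "continuous_map (subtopology (powertop_real UNIV) (standard_simplex p)) X \<sigma>"
    using c by (auto simp: singular_chain_def singular_simplex_def)
  then have "continuous_map (prism p) (prod_topology (top_of_set {0..1}) X) (map_prod id \<sigma>)"
    by (simp add: map_prod_def continuous_map_prod_top)
  then show "singular_chain (Suc p) (prod_topology (top_of_set {0..1}) X)
      (chain_map (Suc p) (map_prod id \<sigma>) P)"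
    by (rule singular_chain_chain_map[OF P])
qed

text \<open>The universal \<open>p\<close>-simplex: every singular \<open>p\<close>-simplex is its image under a chain map.\<close>

definition identity_simplex :: "nat \<Rightarrow> (nat \<Rightarrow> real) chain" where
  "identity_simplex p = frag_of (restrict id (standard_simplex p))"

lemma singular_chain_identity_simplex:
  "singular_chain p (subtopology (powertop_real UNIV) (standard_simplex p)) (identity_simplex p)"
  by (simp add: identity_simplex_def singular_chain_of singular_simplex_def)

text \<open>By naturality the chain homotopy identity follows from its instance for the universal simplex.\<close>

lemma boundary_prism_operator:
  assumes P: "singular_chain (Suc p) (prism p) P"
    and P': "p \<noteq> 0 \<Longrightarrow> singular_chain p (prism (p - 1)) P'"
    and eq: "chain_boundary (Suc p) P = chain_map p (Pair 1) (identity_simplex p)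
      - chain_map p (Pair 0) (identity_simplex p) - prism_operator (p - 1) P' (chain_boundary p (identity_simplex p))"
    and c: "singular_chain p X c"
  shows "chain_boundary (Suc p) (prism_operator p P c)
    = chain_map p (Pair 1) c - chain_map p (Pair 0) c - prism_operator (p - 1) P' (chain_boundary p c)"
  using c unfolding singular_chain_def
proof (induction c rule: frag_induction)
  case (one \<sigma>)
  then have \<sigma>: "singular_simplex p X \<sigma>" by simp
  have "chain_boundary (Suc p) (prism_operator p P (frag_of \<sigma>)) = chain_map p (map_prod id \<sigma>) (chain_boundary (Suc p) P)"
    using chain_boundary_chain_map[OF P] by (simp add: prism_operator_def)
  also have "\<dots> = chain_map p (map_prod id \<sigma>) (chain_map p (Pair 1) (identity_simplex p))
      - chain_map p (map_prod id \<sigma>) (chain_map p (Pair 0) (identity_simplex p))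
      - chain_map p (map_prod id \<sigma>) (prism_operator (p - 1) P' (chain_boundary p (identity_simplex p)))"
    unfolding eq by (simp add: chain_map_diff)
  also have "chain_map p (map_prod id \<sigma>) (chain_map p (Pair 1) (identity_simplex p))
      = chain_map p (Pair 1) (frag_of \<sigma>)"
    by (auto simp: identity_simplex_def simplex_map_def frag_of_eq)
  also have "chain_map p (map_prod id \<sigma>) (chain_map p (Pair 0) (identity_simplex p))
      = chain_map p (Pair 0) (frag_of \<sigma>)"
    by (auto simp: identity_simplex_def simplex_map_def frag_of_eq)
  also have "chain_map p (map_prod id \<sigma>) (prism_operator (p - 1) P' (chain_boundary p (identity_simplex p)))
      = prism_operator (p - 1) P' (chain_boundary p (frag_of \<sigma>))"
  proof (cases p)
    case 0
    then show ?thesis by (simp add: chain_boundary_def prism_operator_def)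
  next
    case (Suc q)
    then have "chain_map p (map_prod id \<sigma>) (prism_operator (p - 1) P' (chain_boundary p (identity_simplex p)))
        = prism_operator q P' (chain_map q \<sigma> (chain_boundary p (identity_simplex p)))"
      using prism_operator_chain_map[of q P' \<sigma>] P' by simp
    also have "chain_map q \<sigma> (chain_boundary p (identity_simplex p))
        = chain_boundary p (chain_map p \<sigma> (identity_simplex p))"
      using chain_boundary_chain_map[OF singular_chain_identity_simplex, of p \<sigma>] Suc by simp
    also have "chain_map p \<sigma> (identity_simplex p) = frag_of \<sigma>"
      unfolding identity_simplex_def by (rule singular_simplex_chain_map_id[OF \<sigma>])
    finally show ?thesis unfolding Suc diff_Suc_1 .
  qed
  finally show ?case .
next
  case (diff a b)
  then show ?case
    by (simp add: prism_operator_def frag_extend_diff chain_boundary_diff chain_map_diff)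
qed (simp add: prism_operator_def)

text \<open>A contraction makes the cycle homologous to its image in a one-point space, where all cycles of
  positive degree are boundaries.\<close>

lemma contractible_cycle_bounds:
  assumes "contractible_space X" "p \<noteq> 0" and z: "singular_chain p X z" "chain_boundary p z = 0"
  shows "\<exists>d. singular_chain (Suc p) X d \<and> chain_boundary (Suc p) d = z"
proof (cases "topspace X = {}")
  case True
  then show ?thesis using z by (auto simp: singular_chain_empty intro: exI[of _ 0])
next
  case False
  then obtain a where "homotopic_with (\<lambda>_. True) X X id (\<lambda>_. a)"
    using assms(1) by (auto simp: contractible_space_def)
  then have hom: "homotopic_with (\<lambda>h. h \<in> {} \<rightarrow> {}) X X id (\<lambda>_. a)" by simp
  have a: "a \<in> topspace X"
    using homotopic_with_imp_continuous_maps[OF hom] False by (auto simp: continuous_map_def)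
  have cyc: "singular_relcycle p X {} z" using z by (simp add: singular_cycle)
  have "homologous_rel p X {} (chain_map p id z) (chain_map p (\<lambda>_. a) z)"
    by (rule homotopic_imp_homologous_rel_chain_maps[OF hom cyc])
  moreover have "singular_relcycle p (subtopology X {a}) {} (chain_map p (\<lambda>_. a) z)"
    by (rule singular_relcycle_chain_map[OF cyc]) (use a in auto)
  then have "singular_relboundary p (subtopology X {a}) {} (chain_map p (\<lambda>_. a) z)"
    using singular_boundary_eq_cycle_singleton[of "subtopology X {a}" a p] a \<open>p \<noteq> 0\<close> by simp
  then have "singular_relboundary p X {} (chain_map p (\<lambda>_. a) z)"
    by (metis singular_boundary_mono subtopology_UNIV subset_UNIV)
  ultimately have "singular_relboundary p X {} z"
    using z(1) chain_map_ident[of p X z]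
    by (metis diff_add_cancel homologous_rel_def singular_relboundary_add)
  then show ?thesis by (simp add: singular_boundary)
qed

text \<open>The chain homotopy identity for the universal \<open>p\<close>-simplex, where \<open>P'\<close> and \<open>P\<close> determine the operator in
  degrees \<open>p - 1\<close> and \<open>p\<close>. For \<open>p = 0\<close> the last term vanishes, as boundaries of \<open>0\<close>-chains are \<open>0\<close>.\<close>

definition prism_step :: "nat \<Rightarrow> (real \<times> (nat \<Rightarrow> real)) chain \<Rightarrow> (real \<times> (nat \<Rightarrow> real)) chain \<Rightarrow> bool" where
  "prism_step p P' P \<longleftrightarrow> chain_boundary (Suc p) P = chain_map p (Pair 1) (identity_simplex p)
      - chain_map p (Pair 0) (identity_simplex p) - prism_operator (p - 1) P' (chain_boundary p (identity_simplex p))"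

lemma continuous_map_Pair_interval:
  "s \<in> {0..1} \<Longrightarrow> continuous_map X (prod_topology (top_of_set {0..1::real}) X) (Pair s)"
  by (simp add: continuous_map_pairwise o_def)

text \<open>The right hand side of the identity in degree \<open>p + 1\<close> is a cycle because the identity holds in degree
  \<open>p\<close>, and the model prism is contractible.\<close>

lemma prism_step_exists:
  assumes P: "singular_chain (Suc p) (prism p) P"
    and P': "p \<noteq> 0 \<Longrightarrow> singular_chain p (prism (p - 1)) P'"
    and step: "prism_step p P' P"
  shows "\<exists>Q. singular_chain (Suc (Suc p)) (prism (Suc p)) Q \<and> prism_step (Suc p) P Q"
proof -
  let ?\<iota> = "identity_simplex (Suc p)"
  let ?b = "chain_boundary (Suc p) ?\<iota>"
  let ?\<Delta> = "subtopology (powertop_real UNIV) (standard_simplex (Suc p))"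
  have b: "singular_chain p ?\<Delta> ?b"
    by (rule singular_chain_boundary_alt[OF singular_chain_identity_simplex])
  let ?z = "chain_map (Suc p) (Pair 1) ?\<iota> - chain_map (Suc p) (Pair 0) ?\<iota> - prism_operator p P ?b"
  have z: "singular_chain (Suc p) (prism (Suc p)) ?z"
    by (intro singular_chain_diff singular_chain_prism_operator[OF P b]
        singular_chain_chain_map[OF singular_chain_identity_simplex] continuous_map_Pair_interval) auto
  have "chain_boundary p ?b = 0"
    by (rule chain_boundary_boundary_alt[OF singular_chain_identity_simplex])
  then have "chain_boundary (Suc p) (prism_operator p P ?b) = chain_map p (Pair 1) ?b - chain_map p (Pair 0) ?b"
    using boundary_prism_operator[OF P P' step[unfolded prism_step_def] b] by (simp add: prism_operator_def)
  moreover have "chain_boundary (Suc p) (chain_map (Suc p) (Pair s) ?\<iota>) = chain_map p (Pair s) ?b" for s :: real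
    using chain_boundary_chain_map[OF singular_chain_identity_simplex, of "Suc p"] by simp
  ultimately have "chain_boundary (Suc p) ?z = 0"
    by (simp add: chain_boundary_diff)
  then show ?thesis
    using contractible_cycle_bounds[OF contractible_prism _ z] by (simp add: prism_step_def)
qed

text \<open>In degree \<open>0\<close> cycles need not bound, but the two ends of the cylinder are homotopic maps.\<close>

lemma prism_0_exists: "\<exists>P. singular_chain (Suc 0) (prism 0) P \<and> prism_step 0 P' P"
proof -
  let ?\<Delta> = "subtopology (powertop_real UNIV) (standard_simplex 0)"
  have "homotopic_with (\<lambda>h. h \<in> {} \<rightarrow> {}) ?\<Delta> (prism 0) (Pair 0) (Pair 1)"
    unfolding homotopic_with_def by (rule exI[of _ id]) auto
  moreover have "singular_relcycle 0 ?\<Delta> {} (identity_simplex 0)"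
    by (simp add: singular_cycle singular_chain_identity_simplex chain_boundary_def)
  ultimately have "homologous_rel 0 (prism 0) {} (chain_map 0 (Pair 0) (identity_simplex 0))
     (chain_map 0 (Pair 1) (identity_simplex 0))"
    by (rule homotopic_imp_homologous_rel_chain_maps)
  then have "singular_relboundary 0 (prism 0) {} (chain_map 0 (Pair 1) (identity_simplex 0)
    - chain_map 0 (Pair 0) (identity_simplex 0))"
    by (meson homologous_rel_def homologous_rel_sym)
  then show ?thesis
    by (auto simp: singular_boundary prism_step_def prism_operator_def chain_boundary_def[of 0])
qed

text \<open>Chains can be chosen one degree at a time, since extending the sequence by one step requires only
  that its last member satisfies the identity for some predecessor.\<close>

lemma prism_sequence:
  "\<exists>P. \<forall>p. singular_chain (Suc p) (prism p) (P p) \<and> prism_step p (P (p - 1)) (P p)"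
proof -
  have "\<exists>P. \<forall>p. (singular_chain (Suc p) (prism p) (P p) \<and>
      (\<exists>P'. (p \<noteq> 0 \<longrightarrow> singular_chain p (prism (p - 1)) P') \<and> prism_step p P' (P p))) \<and>
      prism_step (Suc p) (P p) (P (Suc p))"
    (is "\<exists>P. \<forall>p. ?good p (P p) \<and> ?step p (P p) (P (Suc p))")
  proof (rule dependent_nat_choice)
    show "\<exists>x. ?good 0 x" using prism_0_exists by blast
  next
    fix x p assume "?good p x"
    then obtain P' where x: "singular_chain (Suc p) (prism p) x"
      and "p \<noteq> 0 \<Longrightarrow> singular_chain p (prism (p - 1)) P'" "prism_step p P' x" by blast
    from prism_step_exists[OF this]
    obtain y where "singular_chain (Suc (Suc p)) (prism (Suc p)) y" "prism_step (Suc p) x y"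
      by blast
    then show "\<exists>y. ?good (Suc p) y \<and> ?step p x y"
      using x by (intro exI[of _ y] conjI exI[of _ x]) simp_all
  qed
  then obtain P where P: "\<And>p. ?good p (P p)" "\<And>p. ?step p (P p) (P (Suc p))" by blast
  have "prism_step p (P (p - 1)) (P p)" for p
  proof (cases p)
    case 0
    then show ?thesis using P(1)[of 0] by (auto simp: prism_step_def chain_boundary_def[of 0] prism_operator_def)
  next
    case (Suc q)
    then show ?thesis using P(2)[of q] by simp
  qed
  then show ?thesis using P(1) by blast
qed

text \<open>The integral chain homotopy belonging to a homotopy \<open>h\<close>, given by its values on simplices. This
  form, and not only the resulting equality of homology classes, is what allows other coefficients.\<close>

lemma singular_prism_exists:
  assumes h: "continuous_map (prod_topology (top_of_set {0..1::real}) X) Y h"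
  shows "\<exists>K. (\<forall>p c. singular_chain p X c \<longrightarrow> singular_chain (Suc p) Y (frag_extend (K p) c)) \<and>
    (\<forall>p c. singular_chain p X c \<longrightarrow> chain_boundary (Suc p) (frag_extend (K p) c) =
      chain_map p (\<lambda>x. h (1, x)) c - chain_map p (\<lambda>x. h (0, x)) c -
      frag_extend (K (p - 1)) (chain_boundary p c))"
proof -
  obtain P where P: "\<And>p. singular_chain (Suc p) (prism p) (P p)"
      "\<And>p. prism_step p (P (p - 1)) (P p)"
    using prism_sequence by blast
  define K where "K p \<sigma> = chain_map (Suc p) h (chain_map (Suc p) (map_prod id \<sigma>) (P p))" for p and \<sigma> :: "(nat \<Rightarrow> real) \<Rightarrow> 'a"
  have K: "frag_extend (K p) c = chain_map (Suc p) h (prism_operator p (P p) c)" for p and c :: "'a chain"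
    using subset_UNIV
    by (induction c rule: frag_induction) (auto simp: K_def prism_operator_def frag_extend_diff chain_map_diff)
  show ?thesis
  proof (intro exI[of _ K] conjI allI impI)
    fix p and c :: "'a chain" assume c: "singular_chain p X c"
    have P_c: "singular_chain (Suc p) (prod_topology (top_of_set {0..1}) X) (prism_operator p (P p) c)"
      by (rule singular_chain_prism_operator[OF P(1) c])
    then show "singular_chain (Suc p) Y (frag_extend (K p) c)"
      unfolding K by (rule singular_chain_chain_map[OF _ h])
    have comp: "chain_map p h (chain_map p (Pair s) c) = chain_map p (\<lambda>x. h (s, x)) c" for s
      using chain_map_compose[of p h "Pair s"] by (simp add: o_def fun_eq_iff)
    have last: "chain_map p h (prism_operator (p - 1) (P (p - 1)) (chain_boundary p c))
        = frag_extend (K (p - 1)) (chain_boundary p c)"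
      by (cases p) (simp_all add: K chain_boundary_def[of 0] prism_operator_def)
    have "chain_boundary (Suc p) (frag_extend (K p) c)
        = chain_map p h (chain_boundary (Suc p) (prism_operator p (P p) c))"
      using chain_boundary_chain_map[OF P_c] by (simp add: K)
    also have "chain_boundary (Suc p) (prism_operator p (P p) c) = chain_map p (Pair 1) c
        - chain_map p (Pair 0) c - prism_operator (p - 1) (P (p - 1)) (chain_boundary p c)"
      by (rule boundary_prism_operator[OF P(1) _ P(2)[unfolded prism_step_def] c])
         (use P(1)[of "p - 1"] in simp)
    finally show "chain_boundary (Suc p) (frag_extend (K p) c) =
      chain_map p (\<lambda>x. h (1, x)) c - chain_map p (\<lambda>x. h (0, x)) c -
      frag_extend (K (p - 1)) (chain_boundary p c)"
      by (simp only: chain_map_diff comp last)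
  qed
qed

section \<open>Homotopy invariance over a field\<close>

lemma fchain_map_single [simp]:
  "fchain_map p g (Poly_Mapping.single \<sigma> 1) = Poly_Mapping.single (simplex_map p g \<sigma>) 1"
  by (simp add: fchain_map_lin_extend)

text \<open>The linear extension \<open>L\<close> over the field of the integral chain homotopy again is a chain homotopy, and
  on cycles the term with the boundary of \<open>c\<close> drops out.\<close>

lemma fchain_map_homotopic:
  fixes c :: "('a, 'f::field) fchain"
  assumes hom: "homotopic_with (\<lambda>_. True) X Y f g" and c: "c \<in> fcycles p X"
  shows "fchain_map p g c - fchain_map p f c \<in> fboundaries p Y"
proof -
  obtain h where h: "continuous_map (prod_topology (top_of_set {0..1::real}) X) Y h"
    and h01: "(\<lambda>x. h (0, x)) = f" "(\<lambda>x. h (1, x)) = g"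
    using hom by (auto simp: homotopic_with_def fun_eq_iff)
  obtain K :: "nat \<Rightarrow> ((nat \<Rightarrow> real) \<Rightarrow> 'a) \<Rightarrow> 'b chain" where
    chain: "\<And>q c. singular_chain q X c \<Longrightarrow> singular_chain (Suc q) Y (frag_extend (K q) c)" and
    bd: "\<And>q c. singular_chain q X c \<Longrightarrow> chain_boundary (Suc q) (frag_extend (K q) c) =
      chain_map q g c - chain_map q f c - frag_extend (K (q - 1)) (chain_boundary q c)"
    using singular_prism_exists[OF h] unfolding h01 by blast
  define L :: "nat \<Rightarrow> ('a, 'f) fchain \<Rightarrow> ('b, 'f) fchain" where
    "L q = lin_extend (\<lambda>\<sigma>. coeff_change (K q \<sigma>))" for q
  have supp: "singular_chain p X (frag_of \<sigma>)" if "\<sigma> \<in> Poly_Mapping.keys c" for \<sigma>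
    using that c by (auto simp: fcycles_def fchains_def singular_chain_of)
  have "L p c \<in> fchains (Suc p) Y"
  proof -
    have "Poly_Mapping.keys (coeff_change (K p \<sigma>) :: ('b, 'f) fchain) \<subseteq> singular_simplex_set (Suc p) Y"
      if "\<sigma> \<in> Poly_Mapping.keys c" for \<sigma>
    proof -
      have "Poly_Mapping.keys (coeff_change (K p \<sigma>) :: ('b, 'f) fchain) \<subseteq> Poly_Mapping.keys (K p \<sigma>)"
        by (auto simp: in_keys_iff)
      also have "\<dots> \<subseteq> singular_simplex_set (Suc p) Y"
        using chain[OF supp[OF that]] by (simp add: singular_chain_def)
      finally show ?thesis .
    qed
    then show ?thesis
      unfolding fchains_def L_def using keys_lin_extend by fast
  qed
  moreover have "fboundary (Suc p) (L p c) = fchain_map p g c - fchain_map p f c"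
  proof -
    have "fboundary (Suc p) (coeff_change (K p \<sigma>)) = fchain_map p g (Poly_Mapping.single \<sigma> 1)
        - fchain_map p f (Poly_Mapping.single \<sigma> 1) - L (p - 1) (fboundary p (Poly_Mapping.single \<sigma> 1))"
      if "\<sigma> \<in> Poly_Mapping.keys c" for \<sigma>
      using arg_cong[OF bd[OF supp[OF that]], of "coeff_change :: _ \<Rightarrow> ('b, 'f) fchain"]
      by (simp add: coeff_change_chain_boundary coeff_change_diff coeff_change_chain_map
          coeff_change_frag_extend L_def)
    then have "lin_extend (\<lambda>\<sigma>. fboundary (Suc p) (coeff_change (K p \<sigma>))) c
      = lin_extend (\<lambda>\<sigma>. fchain_map p g (Poly_Mapping.single \<sigma> 1)
        - fchain_map p f (Poly_Mapping.single \<sigma> 1) - L (p - 1) (fboundary p (Poly_Mapping.single \<sigma> 1))) c"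
      by (rule lin_extend_cong)
    then have "fboundary (Suc p) (L p c) = fchain_map p g c - fchain_map p f c - L (p - 1) (fboundary p c)"
      by (simp add: L_def fboundary_lin_extend fchain_map_lin_extend lin_extend_lin_extend
          lin_extend_pointwise_diff)
    then show ?thesis using c by (simp add: fcycles_def L_def)
  qed
  ultimately show ?thesis unfolding fboundaries_def by (metis image_eqI)
qed

lemma fhomology_map_homotopic:
  assumes hom: "homotopic_with (\<lambda>_. True) X Y f g" and A: "A \<in> carrier (fhomology p X)"
  shows "fhomology_map p Y f A = fhomology_map p Y g A"
proof -
  obtain c where c: "c \<in> fcycles p X" "A = homology_class p X c" using A by (auto simp: carrier_fhomology)
  have "continuous_map X Y f" "continuous_map X Y g"
    using homotopic_with_imp_continuous_maps[OF hom] by auto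
  then show ?thesis
    using homology_class_eqI[OF fchain_map_homotopic[OF hom c(1)]] c(2) by (simp add: fhomology_map_homology_class)
qed

section \<open>Interleavings up to homotopy\<close>

text \<open>An interleaving of persistent spaces whose naturality squares and triangles commute up to homotopy
  becomes a strict interleaving in homology.\<close>

lemma homotopy_interleaving_distance:
  fixes Z :: "'a persistent_space" and W :: "'b persistent_space"
  assumes "0 \<le> \<delta>"
    and Z: "\<And>r r'. r \<le> r' \<Longrightarrow> continuous_map (Ob Z r) (Ob Z r') (Mp Z (r, r'))"
    and W: "\<And>r r'. r \<le> r' \<Longrightarrow> continuous_map (Ob W r) (Ob W r') (Mp W (r, r'))"
    and f: "\<And>r. continuous_map (Ob Z r) (Ob W (r + \<delta>)) (f r)"
    and g: "\<And>r. continuous_map (Ob W r) (Ob Z (r + \<delta>)) (g r)"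
    and f_nat: "\<And>r r'. r \<le> r' \<Longrightarrow> homotopic_with (\<lambda>_. True) (Ob Z r) (Ob W (r' + \<delta>))
      (f r' \<circ> Mp Z (r, r')) (Mp W (r + \<delta>, r' + \<delta>) \<circ> f r)"
    and g_nat: "\<And>r r'. r \<le> r' \<Longrightarrow> homotopic_with (\<lambda>_. True) (Ob W r) (Ob Z (r' + \<delta>))
      (g r' \<circ> Mp W (r, r')) (Mp Z (r + \<delta>, r' + \<delta>) \<circ> g r)"
    and fg: "\<And>r. homotopic_with (\<lambda>_. True) (Ob W r) (Ob W (r + 2 * \<delta>))
      (f (r + \<delta>) \<circ> g r) (Mp W (r, r + 2 * \<delta>))"
    and gf: "\<And>r. homotopic_with (\<lambda>_. True) (Ob Z r) (Ob Z (r + 2 * \<delta>))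
      (g (r + \<delta>) \<circ> f r) (Mp Z (r, r + 2 * \<delta>))"
  shows "interleaving_distance (persistent_homology n Z TYPE('f::field))
    (persistent_homology n W TYPE('f)) \<le> ereal \<delta>"
proof -
  let ?M = "persistent_homology n Z TYPE('f)" and ?N = "persistent_homology n W TYPE('f)"
  let ?\<phi> = "\<lambda>r. fhomology_map n (Ob W (r + \<delta>)) (f r)"
  let ?\<psi> = "\<lambda>r. fhomology_map n (Ob Z (r + \<delta>)) (g r)"
  have \<delta>2: "r + \<delta> + \<delta> = r + 2 * \<delta>" for r by simp
  have "pmod_morphism ?M (shift \<delta> ?N) ?\<phi>"
    unfolding pmod_morphism_def shift_def persistent_homology_def
    by (auto simp: fhomology_map_linear f fhomology_map_compose[OF Z f] fhomology_map_compose[OF f W]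
        fhomology_map_homotopic[OF f_nat])
  moreover have "pmod_morphism ?N (shift \<delta> ?M) ?\<psi>"
    unfolding pmod_morphism_def shift_def persistent_homology_def
    by (auto simp: fhomology_map_linear g fhomology_map_compose[OF W g] fhomology_map_compose[OF g Z]
        fhomology_map_homotopic[OF g_nat])
  moreover have "?\<phi> (r + \<delta>) (?\<psi> r y) = shift_unit (2 * \<delta>) ?N r y" if "y \<in> carrier (Ob ?N r)" for r y
    using that fhomology_map_compose[OF g f, where A = y and p = n]
      fhomology_map_homotopic[OF fg, where A = y and p = n]
    by (simp add: persistent_homology_def shift_unit_def \<delta>2)
  moreover have "?\<psi> (r + \<delta>) (?\<phi> r x) = shift_unit (2 * \<delta>) ?M r x" if "x \<in> carrier (Ob ?M r)" for r x
    using that fhomology_map_compose[OF f g, where A = x and p = n]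
      fhomology_map_homotopic[OF gf, where A = x and p = n]
    by (simp add: persistent_homology_def shift_unit_def \<delta>2)
  ultimately have "interleaving \<delta> ?M ?N ?\<phi> ?\<psi>"
    by (simp add: interleaving_def)
  then show ?thesis
    unfolding interleaving_distance_def using \<open>0 \<le> \<delta>\<close> by (intro Inf_lower) blast
qed

section \<open>Quotients and coproducts of spaces\<close>

lemma equiv_eq_closure: "equiv UNIV (eq_closure r)"
  unfolding eq_closure_def
  by (intro equivI) (auto simp: refl_on_def sym_rtrancl sym_Un_converse trans_rtrancl)

lemma eq_closure_class_eq_iff: "eq_closure r `` {x} = eq_closure r `` {y} \<longleftrightarrow> (x, y) \<in> eq_closure r"
  using equiv_eq_closure by (metis UNIV_I eq_equiv_class_iff)

lemma eq_closure_class_eqI: "(x, y) \<in> r \<Longrightarrow> eq_closure r `` {x} = eq_closure r `` {y}"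
  unfolding eq_closure_class_eq_iff unfolding eq_closure_def by auto

lemma eq_closure_respects:
  assumes "\<And>x y. (x, y) \<in> r \<Longrightarrow> f x = f y" and "(x, y) \<in> eq_closure r"
  shows "f x = f y"
  using assms(2) unfolding eq_closure_def by (induction rule: rtrancl_induct) (auto dest: assms(1))

lemma topspace_glue: "topspace (glue X r) = topspace X // eq_closure r"
proof -
  have "openin (glue X r) (topspace X // eq_closure r)"
  proof -
    have "{x \<in> topspace X. eq_closure r `` {x} \<in> topspace X // eq_closure r} = topspace X"
      by (auto intro: quotientI)
    then show ?thesis unfolding openin_glue by simp
  qed
  then show ?thesis
    using openin_subset openin_glue[of X r "topspace (glue X r)"] by (metis openin_topspace subset_antisym)
qed

lemma quotient_map_glue: "quotient_map X (glue X r) (\<lambda>x. eq_closure r `` {x})"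
  unfolding quotient_map_def topspace_glue openin_glue by (auto simp: quotient_def)

lemma glue_map_class:
  assumes "\<And>x y. (x, y) \<in> r \<Longrightarrow> eq_closure s `` {f x} = eq_closure s `` {f y}"
  shows "glue_map s f (eq_closure r `` {x}) = eq_closure s `` {f x}"
proof -
  have "eq_closure s `` {f y} = eq_closure s `` {f x}" if "(x, y) \<in> eq_closure r" for y
    using eq_closure_respects[of r "\<lambda>x. eq_closure s `` {f x}", OF assms that] by simp
  moreover have "(x, x) \<in> eq_closure r" by (simp add: eq_closure_def)
  ultimately show ?thesis unfolding glue_map_def by blast
qed

lemma continuous_map_glue_map:
  assumes f: "continuous_map X Y f"
    and "\<And>x y. (x, y) \<in> r \<Longrightarrow> eq_closure s `` {f x} = eq_closure s `` {f y}"
  shows "continuous_map (glue X r) (glue Y s) (glue_map s f)"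
proof (rule continuous_compose_quotient_map[OF quotient_map_glue])
  have "continuous_map X (glue Y s) (\<lambda>x. eq_closure s `` {f x})"
    using continuous_map_compose[OF f quotient_imp_continuous_map[OF quotient_map_glue]]
    by (simp add: o_def)
  then show "continuous_map X (glue Y s) (glue_map s f \<circ> (\<lambda>x. eq_closure r `` {x}))"
    by (simp add: o_def glue_map_class[of r, OF assms(2)])
qed

text \<open>A homotopy that respects the identifications for each parameter descends to the quotient. As
  \<open>[0, 1]\<close> is locally compact and Hausdorff, its product with a quotient map is a quotient map.\<close>

lemma glue_homotopy:
  assumes h: "continuous_map (prod_topology (top_of_set {0..1::real}) X) Z h"
    and resp: "\<And>s x y. s \<in> {0..1} \<Longrightarrow> (x, y) \<in> r \<Longrightarrow> h (s, x) = h (s, y)"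
  shows "\<exists>H. continuous_map (prod_topology (top_of_set {0..1::real}) (glue X r)) Z H \<and>
    (\<forall>s\<in>{0..1}. \<forall>x\<in>topspace X. H (s, eq_closure r `` {x}) = h (s, x))"
proof -
  have loc: "locally_compact_space (top_of_set {0..1::real})"
    by (simp add: compact_imp_locally_compact_space compact_space_subtopology)
  have q: "quotient_map (prod_topology (top_of_set {0..1::real}) X)
      (prod_topology (top_of_set {0..1}) (glue X r)) (\<lambda>(s, x). (s, eq_closure r `` {x}))"
    by (rule quotient_map_prod_right[OF loc _ quotient_map_glue])
       (simp add: Hausdorff_space_subtopology)
  have "h a = h b" if "a \<in> topspace (prod_topology (top_of_set {0..1::real}) X)"
    "b \<in> topspace (prod_topology (top_of_set {0..1::real}) X)"
    "(\<lambda>(s, x). (s, eq_closure r `` {x})) a = (\<lambda>(s, x). (s, eq_closure r `` {x})) b" for a b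
  proof -
    obtain s x y where "a = (s, x)" "b = (s, y)" "s \<in> {0..1}" "(x, y) \<in> eq_closure r"
      using \<open>a \<in> _\<close> \<open>(\<lambda>(s, x). _) a = _\<close>
      by (cases a, cases b) (auto simp: eq_closure_class_eq_iff)
    then show ?thesis using eq_closure_respects[of r "\<lambda>x. h (s, x)"] resp by auto
  qed
  from q h this show ?thesis
  proof (rule quotient_map_lift_exists)
    fix H assume "continuous_map (prod_topology (top_of_set {0..1}) (glue X r)) Z H"
      and eq: "\<And>a. a \<in> topspace (prod_topology (top_of_set {0..1}) X) \<Longrightarrow>
        H (case a of (s, x) \<Rightarrow> (s, eq_closure r `` {x})) = h a"
    moreover have "H (s, eq_closure r `` {x}) = h (s, x)" if "s \<in> {0..1}" "x \<in> topspace X" for s x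
      using eq[of "(s, x)"] that by simp
    ultimately show ?thesis by (intro exI[of _ H]) blast
  qed
qed

lemma continuous_map_sum_topology:
  assumes "\<And>i. i \<in> I \<Longrightarrow> continuous_map (X i) Z (\<lambda>x. f (i, x))"
  shows "continuous_map (sum_topology X I) Z f"
  unfolding continuous_map_alt
proof (intro conjI allI impI)
  fix U assume U: "openin Z U"
  have "{x. (i, x) \<in> f -` U \<inter> topspace (sum_topology X I)} = (\<lambda>x. f (i, x)) -` U \<inter> topspace (X i)"
    if "i \<in> I" for i using that by auto
  then show "openin (sum_topology X I) (f -` U \<inter> topspace (sum_topology X I))"
    unfolding openin_sum_topology using U assms by (auto simp: continuous_map_alt)
qed (use assms in \<open>auto simp: continuous_map_def Pi_iff\<close>)

text \<open>The product with a fixed space distributes over coproducts, since the summands are open.\<close>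

lemma continuous_map_prod_sum_topology:
  assumes f: "\<And>i. i \<in> I \<Longrightarrow> continuous_map (prod_topology J (X i)) Z (\<lambda>(s, x). f (s, i, x))"
  shows "continuous_map (prod_topology J (sum_topology X I)) Z f"
  unfolding continuous_map_alt
proof (intro conjI allI impI)
  fix U assume U: "openin Z U"
  let ?T = "topspace (prod_topology J (sum_topology X I))"
  show "openin (prod_topology J (sum_topology X I)) (f -` U \<inter> ?T)"
    unfolding openin_prod_topology_alt
  proof (intro allI impI)
    fix s z assume "(s, z) \<in> f -` U \<inter> ?T"
    then obtain i x where z: "z = (i, x)" "i \<in> I" "x \<in> topspace (X i)" "s \<in> topspace J" "f (s, i, x) \<in> U"
      by auto
    let ?S = "{z \<in> topspace (prod_topology J (X i)). (\<lambda>(s, x). f (s, i, x)) z \<in> U}"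
    have "openin (prod_topology J (X i)) ?S"
      using openin_continuous_map_preimage[OF f[OF z(2)] U] .
    moreover have "(s, x) \<in> ?S" using z by simp
    ultimately have "\<exists>V W. openin J V \<and> openin (X i) W \<and> s \<in> V \<and> x \<in> W \<and> V \<times> W \<subseteq> ?S"
      by (simp only: openin_prod_topology_alt)
    then obtain V W where VW: "openin J V" "openin (X i) W" "s \<in> V" "x \<in> W" "V \<times> W \<subseteq> ?S"
      by blast
    have "openin (sum_topology X I) (Pair i ` W)"
      using open_map_component_injection[OF z(2), of X] VW(2) unfolding open_map_def by blast
    moreover have "V \<times> Pair i ` W \<subseteq> f -` U \<inter> ?T"
    proof
      fix y assume "y \<in> V \<times> Pair i ` W"
      then obtain s' x' where "y = (s', i, x')" "(s', x') \<in> V \<times> W" by blast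
      then show "y \<in> f -` U \<inter> ?T" using subsetD[OF VW(5), of "(s', x')"] z(2) by auto
    qed
    ultimately show "\<exists>V W. openin J V \<and> openin (sum_topology X I) W \<and> s \<in> V \<and> z \<in> W \<and>
        V \<times> W \<subseteq> f -` U \<inter> ?T"
      using VW(1,3,4) z(1) by blast
  qed
next
  show "f \<in> topspace (prod_topology J (sum_topology X I)) \<rightarrow> topspace Z"
  proof
    fix z assume "z \<in> topspace (prod_topology J (sum_topology X I))"
    then obtain s i x where "z = (s, i, x)" "i \<in> I" "(s, x) \<in> topspace (prod_topology J (X i))"
      by (cases z) auto
    then show "f z \<in> topspace Z"
      using continuous_map_image_subset_topspace[OF f[of i]] by (simp add: image_subset_iff)
  qed
qed

section \<open>Classifying spaces of opposite undercategories of a preorder\<close>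

abbreviation under_op :: "'o set \<Rightarrow> ('o \<Rightarrow> 'o \<Rightarrow> bool) \<Rightarrow> 'o \<Rightarrow>
    ('o \<times> 'o, ('o \<times> 'o) \<times> ('o \<times> 'o) \<times> ('o \<times> 'o)) small_cat" where
  "under_op P lq i \<equiv> op_cat (under_cat (poset_cat P lq) i)"

text \<open>The simplices of the nerve of the opposite of \<open>(i \<down> P)\<close> are the sequences described here: an
  arrow of the opposite category points downwards in \<open>P\<close>.\<close>

definition descending :: "'o set \<Rightarrow> ('o \<Rightarrow> 'o \<Rightarrow> bool) \<Rightarrow> 'o \<Rightarrow> nat \<Rightarrow> (nat \<Rightarrow> 'o) \<Rightarrow> bool" where
  "descending P lq i k p \<longleftrightarrow>
    (\<forall>a\<le>k. p a \<in> P \<and> lq i (p a)) \<and> (\<forall>a b. a \<le> b \<and> b \<le> k \<longrightarrow> lq (p b) (p a))"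

text \<open>The functor on an ordinal defined by a descending sequence \<open>p\<close>. The triple at \<open>(a, b)\<close> is the arrow
  \<open>p b \<le> p a\<close> under \<open>i\<close>, which in the opposite category goes from \<open>p a\<close> to \<open>p b\<close>.\<close>

definition chain_simplex :: "'o \<Rightarrow> (nat \<Rightarrow> 'o) \<Rightarrow> nat \<Rightarrow> nat \<times> nat \<Rightarrow>
    ('o \<times> 'o) \<times> ('o \<times> 'o) \<times> ('o \<times> 'o)" where
  "chain_simplex i p k = restrict (\<lambda>(a, b). ((i, p b), (p b, p a), (i, p a))) (ordinal_arrows k)"

lemma Arr_under_op:
  "u \<in> Arr (under_op P lq i) \<longleftrightarrow>
    (\<exists>x y. u = ((i, x), (x, y), (i, y)) \<and> i \<in> P \<and> x \<in> P \<and> y \<in> P \<and> lq i x \<and> lq i y \<and> lq x y)"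
  by (cases u) (auto simp: op_cat_def under_cat_def poset_cat_def)

lemma under_op_simps:
  "Src (under_op P lq i) (f, h, g) = g" "Tgt (under_op P lq i) (f, h, g) = f"
  "Idt (under_op P lq i) (i, x) = ((i, x), (x, x), (i, x))"
  "Comp (under_op P lq i) ((i, z), (z, y), (i, y)) ((i, y), (y, x), (i, x)) = ((i, z), (z, x), (i, x))"
  "Obj (under_op P lq i) = {(i, x) | x. i \<in> P \<and> x \<in> P \<and> lq i x}"
  by (auto simp: op_cat_def under_cat_def poset_cat_def)

lemma chain_simplex_in_nerve:
  assumes "i \<in> P" "descending P lq i k p"
  shows "chain_simplex i p k \<in> nerve (under_op P lq i) k"
  unfolding nerve_def
proof (intro CollectI conjI allI impI)
  fix a assume "a \<le> k"
  then show "\<exists>x\<in>Obj (under_op P lq i). chain_simplex i p k (a, a) = Idt (under_op P lq i) x"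
    using assms
    by (intro bexI[of _ "(i, p a)"]) (auto simp: chain_simplex_def under_op_simps descending_def)
qed (use assms in \<open>auto simp: chain_simplex_def Arr_under_op under_op_simps descending_def\<close>)

text \<open>In a preorder there is at most one arrow between two objects, so a functor on an ordinal is determined
  by its values on objects. These are read off from the identity arrows.\<close>

lemma nerve_chain_simplex:
  assumes "\<sigma> \<in> nerve (under_op P lq i) k"
  obtains p where "descending P lq i k p" "\<sigma> = chain_simplex i p k"
proof
  let ?C = "under_op P lq i"
  define p where "p = (\<lambda>a. snd (fst (\<sigma> (a, a))))"
  have ext: "\<sigma> \<in> extensional (ordinal_arrows k)"
    and arr: "\<And>a b. a \<le> b \<Longrightarrow> b \<le> k \<Longrightarrow> \<sigma> (a, b) \<in> Arr ?C"
    and idt: "\<And>a. a \<le> k \<Longrightarrow> \<exists>x\<in>Obj ?C. \<sigma> (a, a) = Idt ?C x"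
    and comp: "\<And>a b c. a \<le> b \<Longrightarrow> b \<le> c \<Longrightarrow> c \<le> k \<Longrightarrow> Src ?C (\<sigma> (b, c)) = Tgt ?C (\<sigma> (a, b))"
    using assms by (auto simp: nerve_def)
  have diag: "\<sigma> (a, a) = ((i, p a), (p a, p a), (i, p a))" if "a \<le> k" for a
    using idt[OF that] by (auto simp: p_def under_op_simps)
  have \<sigma>: "\<sigma> (a, b) = ((i, p b), (p b, p a), (i, p a))" if ab: "a \<le> b" "b \<le> k" for a b
  proof -
    obtain x y where xy: "\<sigma> (a, b) = ((i, x), (x, y), (i, y))"
      using arr[OF ab] by (auto simp: Arr_under_op)
    have "x = p b" using comp[of a b b] ab diag[of b] xy by (simp add: under_op_simps)
    moreover have "y = p a" using comp[of a a b] ab diag[of a] xy by (simp add: under_op_simps)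
    ultimately show ?thesis using xy by simp
  qed
  show "\<sigma> = chain_simplex i p k"
    by (rule extensionalityI[OF ext]) (auto simp: chain_simplex_def \<sigma>)
  show "descending P lq i k p"
    unfolding descending_def using arr \<sigma> by (auto simp: Arr_under_op)
qed

lemma chain_simplex_cong:
  "(\<And>a. a \<le> k \<Longrightarrow> p a = q a) \<Longrightarrow> chain_simplex i p k = chain_simplex i q k"
  by (auto simp: chain_simplex_def intro!: restrict_ext)

lemma chain_simplex_vertex: "a \<le> k \<Longrightarrow> snd (fst (chain_simplex i p k (a, a))) = p a"
  by (simp add: chain_simplex_def)

lemma nerve_pullback_chain_simplex:
  assumes "mono_on {..m} \<theta>" "\<theta> ` {..m} \<subseteq> {..k}"
  shows "nerve_pullback m \<theta> (chain_simplex i p k) = chain_simplex i (p \<circ> \<theta>) m"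
  unfolding nerve_pullback_def chain_simplex_def
  by (rule restrict_ext) (use assms in \<open>auto simp: mono_on_def\<close>)

text \<open>The point with barycentric coordinates \<open>t\<close> on the simplex of the sequence \<open>p\<close>. Every
  point of the classifying space is of this form, and maps are described by their effect on \<open>p\<close> and \<open>t\<close>.\<close>

definition under_class :: "'o set \<Rightarrow> ('o \<Rightarrow> 'o \<Rightarrow> bool) \<Rightarrow> 'o \<Rightarrow> (nat \<Rightarrow> 'o) \<Rightarrow> nat \<Rightarrow>
    (nat \<Rightarrow> real) \<Rightarrow> ('o \<times> 'o) under_pt" where
  "under_class P lq i p k t = eq_closure (realization_rel (under_op P lq i)) `` {((k, chain_simplex i p k), t)}"

lemma topspace_realization_sum:
  "topspace (realization_sum C) = {((k, \<sigma>), t). \<sigma> \<in> nerve C k \<and> t \<in> standard_simplex k}"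
  by (auto simp: realization_sum_def)

lemma under_class_in_under_space:
  assumes "i \<in> P" "descending P lq i k p" "t \<in> standard_simplex k"
  shows "under_class P lq i p k t \<in> topspace (under_space (poset_cat P lq) i)"
  using assms chain_simplex_in_nerve[OF assms(1,2)]
  unfolding under_class_def under_space_def classifying_space_def topspace_glue
  by (auto intro!: quotientI simp: topspace_realization_sum)

lemma under_space_cases:
  assumes "b \<in> topspace (under_space (poset_cat P lq) i)"
  obtains p k t where "descending P lq i k p" "t \<in> standard_simplex k" "b = under_class P lq i p k t"
  using assms unfolding under_class_def under_space_def classifying_space_def topspace_glue
  by (auto simp: topspace_realization_sum elim!: quotientE) (metis nerve_chain_simplex)

lemma under_class_pushforward:
  assumes "i \<in> P" "descending P lq i k p" "mono_on {..m} \<theta>" "\<theta> ` {..m} \<subseteq> {..k}" "t \<in> standard_simplex m"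
  shows "under_class P lq i (p \<circ> \<theta>) m t = under_class P lq i p k (simplex_pushforward m \<theta> t)"
  unfolding under_class_def
  by (rule eq_closure_class_eqI)
     (use assms chain_simplex_in_nerve[OF assms(1,2)] nerve_pullback_chain_simplex[OF assms(3,4), of i p]
      in \<open>force simp: realization_rel_def\<close>)

lemma realization_rel_cases:
  assumes "(x, y) \<in> realization_rel (under_op P lq i)"
  obtains m k \<theta> p t where "descending P lq i k p" "t \<in> standard_simplex m"
    "mono_on {..m} \<theta>" "\<theta> ` {..m} \<subseteq> {..k}" "x = ((m, chain_simplex i (p \<circ> \<theta>) m), t)"
    "y = ((k, chain_simplex i p k), simplex_pushforward m \<theta> t)"
proof -
  obtain m k \<theta> \<sigma> t where *: "\<sigma> \<in> nerve (under_op P lq i) k" "t \<in> standard_simplex m"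
    "mono_on {..m} \<theta>" "\<theta> ` {..m} \<subseteq> {..k}" "x = ((m, nerve_pullback m \<theta> \<sigma>), t)"
    "y = ((k, \<sigma>), simplex_pushforward m \<theta> t)"
    using assms by (auto simp: realization_rel_def)
  obtain p where "descending P lq i k p" "\<sigma> = chain_simplex i p k"
    using nerve_chain_simplex[OF *(1)] .
  then show thesis using that * nerve_pullback_chain_simplex[OF *(3,4), of i p] by metis
qed

text \<open>Passing to a larger preorder and precomposing with an arrow \<open>i \<le> j\<close> both leave the sequence \<open>p\<close> and
  the coordinates as they are.\<close>

lemma classifying_map_under_class:
  assumes F: "\<And>x y. F ((j, x), (x, y), (j, y)) = ((i, x), (x, y), (i, y))"
    and desc: "\<And>k p. descending P lq j k p \<Longrightarrow> descending Q lq i k p" and "i \<in> Q"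
  shows "classifying_map (under_op Q lq i) F (under_class P lq j p k t) = under_class Q lq i p k t" (is ?value)
    and "continuous_map (under_space (poset_cat P lq) j) (under_space (poset_cat Q lq) i)
      (classifying_map (under_op Q lq i) F)" (is ?continuous)
proof -
  let ?f = "\<lambda>((k, \<sigma>), t). ((k, restrict (F \<circ> \<sigma>) (ordinal_arrows k)), t)"
  let ?r = "realization_rel (under_op P lq j)" and ?s = "realization_rel (under_op Q lq i)"
  have F_chain: "restrict (F \<circ> chain_simplex j p k) (ordinal_arrows k) = chain_simplex i p k" for p k
    by (auto simp: chain_simplex_def F intro!: restrict_ext)
  have resp: "eq_closure ?s `` {?f x} = eq_closure ?s `` {?f y}" if "(x, y) \<in> ?r" for x y
    using that
  proof (cases rule: realization_rel_cases)
    case (1 m k \<theta> p t)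
    then show ?thesis
      using under_class_pushforward[OF \<open>i \<in> Q\<close> desc[OF 1(1)] 1(3,4,2)]
      by (simp add: F_chain under_class_def)
  qed
  show ?value
    unfolding classifying_map_def under_class_def by (subst glue_map_class[OF resp]) (simp_all add: F_chain)
  have "continuous_map (realization_sum (under_op P lq j)) (realization_sum (under_op Q lq i)) ?f"
    unfolding realization_sum_def
  proof (rule continuous_map_sum_topology, clarsimp)
    fix k \<sigma> assume "\<sigma> \<in> nerve (under_op P lq j) k"
    then obtain p where "descending P lq j k p" "\<sigma> = chain_simplex j p k" by (rule nerve_chain_simplex)
    then have "(k, restrict (F \<circ> \<sigma>) (ordinal_arrows k)) \<in> (SIGMA k:UNIV. nerve (under_op Q lq i) k)"
      using chain_simplex_in_nerve[OF \<open>i \<in> Q\<close> desc] by (simp add: F_chain)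
    from continuous_map_component_injection[OF this,
        of "\<lambda>(k, \<sigma>). subtopology (powertop_real UNIV) (standard_simplex k)"]
    show "continuous_map (subtopology (powertop_real UNIV) (standard_simplex k))
        (sum_topology (\<lambda>(k, \<sigma>). subtopology (powertop_real UNIV) (standard_simplex k))
          (SIGMA k:UNIV. nerve (under_op Q lq i) k))
        (Pair (k, restrict (F \<circ> \<sigma>) (ordinal_arrows k)))"
      by simp
  qed
  then show ?continuous
    unfolding under_space_def classifying_space_def classifying_map_def
    by (rule continuous_map_glue_map[OF _ resp])
qed

section \<open>The cone homotopy\<close>

text \<open>Barycentric coordinates after a new vertex \<open>0\<close> has received the weight \<open>s\<close>, the weights of the old
  vertices being scaled by \<open>1 - s\<close>.\<close>

definition cone_coords :: "real \<Rightarrow> (nat \<Rightarrow> real) \<Rightarrow> nat \<Rightarrow> real" where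
  "cone_coords s t = case_nat s (\<lambda>a. (1 - s) * t a)"

lemma cone_coords_in_standard_simplex:
  assumes "s \<in> {0..1}" "t \<in> standard_simplex k"
  shows "cone_coords s t \<in> standard_simplex (Suc k)"
proof -
  have t: "\<And>a. 0 \<le> t a" "\<And>a. t a \<le> 1" "\<And>a. a > k \<Longrightarrow> t a = 0" "(\<Sum>a\<le>k. t a) = 1"
    using assms(2) by (auto simp: standard_simplex_def)
  have "(\<Sum>a\<le>Suc k. cone_coords s t a) = s + (1 - s) * (\<Sum>a\<le>k. t a)"
    by (simp only: sum.atMost_Suc_shift) (simp add: cone_coords_def sum_distrib_left)
  moreover have "0 \<le> cone_coords s t a \<and> cone_coords s t a \<le> 1" for a
    using assms(1) t(1,2) by (cases a) (auto simp: cone_coords_def mult_le_one)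
  moreover have "cone_coords s t a = 0" if "a > Suc k" for a
    using that t(3) by (cases a) (auto simp: cone_coords_def)
  ultimately show ?thesis by (simp add: standard_simplex_def t(4))
qed

lemma continuous_map_cone_coords:
  "continuous_map (prod_topology (top_of_set {0..1}) (subtopology (powertop_real UNIV) (standard_simplex k)))
    (subtopology (powertop_real UNIV) (standard_simplex (Suc k))) (\<lambda>(s, t). cone_coords s t)"
  (is "continuous_map ?X _ _")
proof -
  have fst: "continuous_map ?X euclideanreal fst"
    using continuous_map_fst continuous_map_into_fulltopology by blast
  have snd: "continuous_map ?X euclideanreal (\<lambda>z. snd z a)" for a
    using continuous_map_compose[OF continuous_map_snd
        continuous_map_from_subtopology[OF continuous_map_product_projection[of a UNIV]]]
    by (simp add: o_def)
  have "continuous_map ?X euclideanreal (\<lambda>z. cone_coords (fst z) (snd z) a)" for a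
    by (cases a) (auto simp: cone_coords_def intro!: continuous_intros fst snd)
  then show ?thesis
    unfolding continuous_map_in_subtopology continuous_map_componentwise_UNIV case_prod_unfold
    by (auto simp: cone_coords_in_standard_simplex)
qed

text \<open>The cone construction is natural for the maps of ordinals by which simplices are identified.\<close>

lemma simplex_pushforward_cone_coords:
  "simplex_pushforward (Suc m) (case_nat 0 (\<lambda>a. Suc (\<theta> a))) (cone_coords s t)
    = cone_coords s (simplex_pushforward m \<theta> t)"
proof
  fix b
  show "simplex_pushforward (Suc m) (case_nat 0 (\<lambda>a. Suc (\<theta> a))) (cone_coords s t) b
    = cone_coords s (simplex_pushforward m \<theta> t) b"
  proof (cases b)
    case 0
    then have "a = 0" if "case_nat 0 (\<lambda>a. Suc (\<theta> a)) a = b" for a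
      using that by (cases a) auto
    then have "{a. a \<le> Suc m \<and> case_nat 0 (\<lambda>a. Suc (\<theta> a)) a = b} = {0}"
      using 0 by auto
    then show ?thesis using 0 by (simp add: simplex_pushforward_def cone_coords_def)
  next
    case (Suc c)
    then have "{a. a \<le> Suc m \<and> case_nat 0 (\<lambda>a. Suc (\<theta> a)) a = b} = Suc ` {a. a \<le> m \<and> \<theta> a = c}"
    proof -
      have "(a \<le> Suc m \<and> case_nat 0 (\<lambda>a. Suc (\<theta> a)) a = b) = (a \<in> Suc ` {a. a \<le> m \<and> \<theta> a = c})" for a
        using Suc by (cases a) auto
      then show ?thesis by blast
    qed
    then show ?thesis
      using Suc by (simp add: simplex_pushforward_def cone_coords_def sum.reindex sum_distrib_left)
  qed
qed

lemma cone_coords_0: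
  "t \<in> standard_simplex k \<Longrightarrow> cone_coords 0 t = simplex_pushforward k Suc t"
proof
  fix b assume t: "t \<in> standard_simplex k"
  show "cone_coords 0 t b = simplex_pushforward k Suc t b"
  proof (cases b)
    case 0
    then show ?thesis by (simp add: cone_coords_def simplex_pushforward_def)
  next
    case (Suc c)
    then have "{a. a \<le> k \<and> Suc a = b} = (if c \<le> k then {c} else {})" by auto
    then show ?thesis using Suc t by (auto simp: cone_coords_def simplex_pushforward_def standard_simplex_def)
  qed
qed

definition vertex_coords :: "nat \<Rightarrow> real" where
  "vertex_coords = (\<lambda>a. if a = 0 then 1 else 0)"

lemma vertex_coords_in_standard_simplex [simp]: "vertex_coords \<in> standard_simplex k"
  by (simp add: vertex_coords_def)

lemma cone_coords_1: "cone_coords 1 t = simplex_pushforward 0 (\<lambda>_. 0) vertex_coords"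
  by (rule ext) (auto simp: cone_coords_def simplex_pushforward_def vertex_coords_def split: nat.splits)

lemma descending_cone:
  assumes "descending P lq i k p" "P \<subseteq> Q" "apex \<in> Q" "lq apex apex" "lq i apex" "\<And>x. x \<in> P \<Longrightarrow> lq x apex"
  shows "descending Q lq i (Suc k) (case_nat apex p)"
  using assms unfolding descending_def by (auto split: nat.splits)

text \<open>Prepending \<open>apex\<close> to a descending sequence of elements of \<open>P\<close> gives a descending sequence in \<open>Q\<close>.
  The homotopy moves the weight to this new vertex.\<close>

lemma cone_homotopy:
  fixes i :: 'o
  assumes "P \<subseteq> Q" "i \<in> P" "apex \<in> Q" "lq apex apex" and apex: "\<And>x. x \<in> P \<Longrightarrow> lq x apex"
  shows "\<exists>H. continuous_map (prod_topology (top_of_set {0..1::real}) (under_space (poset_cat P lq) i))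
      (under_space (poset_cat Q lq) i) H \<and>
    (\<forall>s\<in>{0..1}. \<forall>k p. \<forall>t\<in>standard_simplex k. descending P lq i k p \<longrightarrow>
      H (s, under_class P lq i p k t) = under_class Q lq i (case_nat apex p) (Suc k) (cone_coords s t))"
proof -
  have "i \<in> Q" using assms by auto
  note desc = descending_cone[where lq = lq and i = i, OF _ assms(1,3,4) apex[OF \<open>i \<in> P\<close>] apex]
  let ?q = "\<lambda>x. eq_closure (realization_rel (under_op Q lq i)) `` {x}"
  \<comment> \<open>The vertices of a simplex of the nerve are recovered from its identity arrows.\<close>
  define h :: "real \<times> (('o \<times> 'o) \<times> ('o \<times> 'o) \<times> ('o \<times> 'o)) realization_pt \<Rightarrow> ('o \<times> 'o) under_pt"
    where "h = (\<lambda>(s, (k, \<sigma>), t). ?q ((Suc k,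
    chain_simplex i (case_nat apex (\<lambda>a. snd (fst (\<sigma> (a, a))))) (Suc k)), cone_coords s t))"
  have h: "h (s, (k, chain_simplex i p k), t)
      = under_class Q lq i (case_nat apex p) (Suc k) (cone_coords s t)" for s k p t
  proof -
    have "chain_simplex i (case_nat apex (\<lambda>a. snd (fst (chain_simplex i p k (a, a))))) (Suc k)
        = chain_simplex i (case_nat apex p) (Suc k)"
      by (rule chain_simplex_cong) (simp add: chain_simplex_vertex split: nat.splits)
    then show ?thesis by (simp add: h_def under_class_def)
  qed
  have "continuous_map (prod_topology (top_of_set {0..1::real}) (realization_sum (under_op P lq i)))
      (under_space (poset_cat Q lq) i) h"
    unfolding realization_sum_def
  proof (rule continuous_map_prod_sum_topology, clarsimp)
    fix k \<sigma> assume "\<sigma> \<in> nerve (under_op P lq i) k"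
    then obtain p where p: "descending P lq i k p" "\<sigma> = chain_simplex i p k" by (rule nerve_chain_simplex)
    let ?\<sigma> = "chain_simplex i (case_nat apex p) (Suc k)"
    have "(Suc k, ?\<sigma>) \<in> (SIGMA k:UNIV. nerve (under_op Q lq i) k)"
      using chain_simplex_in_nerve[OF \<open>i \<in> Q\<close> desc[OF p(1)]] by simp
    from continuous_map_component_injection[OF this,
        of "\<lambda>(k, \<sigma>). subtopology (powertop_real UNIV) (standard_simplex k)"]
    have "continuous_map (subtopology (powertop_real UNIV) (standard_simplex (Suc k)))
        (realization_sum (under_op Q lq i)) (Pair (Suc k, ?\<sigma>))"
      by (simp add: realization_sum_def)
    from continuous_map_compose[OF continuous_map_compose[OF continuous_map_cone_coords this]
        quotient_imp_continuous_map[OF quotient_map_glue]]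
    have "continuous_map (prod_topology (top_of_set {0..1}) (subtopology (powertop_real UNIV) (standard_simplex k)))
      (under_space (poset_cat Q lq) i) (\<lambda>(s, t). ?q ((Suc k, ?\<sigma>), cone_coords s t))"
      by (simp add: under_space_def classifying_space_def o_def case_prod_unfold)
    then show "continuous_map (prod_topology (top_of_set {0..1}) (subtopology (powertop_real UNIV) (standard_simplex k)))
        (under_space (poset_cat Q lq) i) (\<lambda>(s, t). h (s, (k, \<sigma>), t))"
      by (simp add: p(2) h under_class_def)
  qed
  moreover have "h (s, x) = h (s, y)" if "s \<in> {0..1}" "(x, y) \<in> realization_rel (under_op P lq i)" for s x y
    using that(2)
  proof (cases rule: realization_rel_cases)
    case (1 m k \<theta> p t)
    let ?\<theta> = "case_nat 0 (\<lambda>a. Suc (\<theta> a))"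
    have "mono_on {..Suc m} ?\<theta>"
      using 1(3) by (auto simp: mono_on_def split: nat.splits)
    moreover have "?\<theta> ` {..Suc m} \<subseteq> {..Suc k}"
      using 1(4) by (auto simp: image_subset_iff split: nat.splits)
    ultimately have "under_class Q lq i (case_nat apex p \<circ> ?\<theta>) (Suc m) (cone_coords s t)
        = under_class Q lq i (case_nat apex p) (Suc k) (simplex_pushforward (Suc m) ?\<theta> (cone_coords s t))"
      by (intro under_class_pushforward \<open>i \<in> Q\<close> desc 1(1) cone_coords_in_standard_simplex that(1) 1(2))
    moreover have "case_nat apex p \<circ> ?\<theta> = case_nat apex (p \<circ> \<theta>)"
      by (auto simp: fun_eq_iff split: nat.splits)
    ultimately show ?thesis
      by (simp add: 1(5,6) h simplex_pushforward_cone_coords)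
  qed
  ultimately have "\<exists>H. continuous_map (prod_topology (top_of_set {0..1::real})
      (glue (realization_sum (under_op P lq i)) (realization_rel (under_op P lq i))))
      (under_space (poset_cat Q lq) i) H \<and>
    (\<forall>s\<in>{0..1}. \<forall>x\<in>topspace (realization_sum (under_op P lq i)).
      H (s, eq_closure (realization_rel (under_op P lq i)) `` {x}) = h (s, x))"
    by (rule glue_homotopy)
  then obtain H where H_cont: "continuous_map (prod_topology (top_of_set {0..1::real})
      (glue (realization_sum (under_op P lq i)) (realization_rel (under_op P lq i))))
      (under_space (poset_cat Q lq) i) H"
    and H: "\<And>s x. s \<in> {0..1} \<Longrightarrow> x \<in> topspace (realization_sum (under_op P lq i)) \<Longrightarrow>
      H (s, eq_closure (realization_rel (under_op P lq i)) `` {x}) = h (s, x)"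
    by blast
  have H_val: "H (s, under_class P lq i p k t)
      = under_class Q lq i (case_nat apex p) (Suc k) (cone_coords s t)"
    if "s \<in> {0..1}" "descending P lq i k p" "t \<in> standard_simplex k" for s p k t
    using H[of s "((k, chain_simplex i p k), t)"] that chain_simplex_in_nerve[OF \<open>i \<in> P\<close> that(2)]
    by (simp add: h under_class_def topspace_realization_sum)
  have "continuous_map (prod_topology (top_of_set {0..1::real}) (under_space (poset_cat P lq) i))
      (under_space (poset_cat Q lq) i) H"
    using H_cont by (simp only: under_space_def classifying_space_def)
  with H_val show ?thesis by (intro exI[of _ H] conjI ballI allI impI)
qed

text \<open>Weight \<open>0\<close> at the apex leaves a point on the face opposite to it, and weight \<open>1\<close> leaves the apex.\<close>

lemma cone_homotopy_ends:
  assumes "P \<subseteq> Q" "i \<in> P" "apex \<in> Q" "lq apex apex" "\<And>x. x \<in> P \<Longrightarrow> lq x apex"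
    and "descending P lq i k p" "t \<in> standard_simplex k"
  shows "under_class Q lq i (case_nat apex p) (Suc k) (cone_coords 0 t) = under_class Q lq i p k t"
    and "under_class Q lq i (case_nat apex p) (Suc k) (cone_coords 1 t)
      = under_class Q lq i (\<lambda>_. apex) 0 vertex_coords"
proof -
  have "i \<in> Q" using assms by auto
  have desc: "descending Q lq i (Suc k) (case_nat apex p)"
    using assms by (intro descending_cone) auto
  have "case_nat apex p \<circ> Suc = p" "case_nat apex p \<circ> (\<lambda>_. 0) = (\<lambda>_. apex)" by auto
  then show "under_class Q lq i (case_nat apex p) (Suc k) (cone_coords 0 t) = under_class Q lq i p k t"
    "under_class Q lq i (case_nat apex p) (Suc k) (cone_coords 1 t)
      = under_class Q lq i (\<lambda>_. apex) 0 vertex_coords"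
    using under_class_pushforward[OF \<open>i \<in> Q\<close> desc, of k Suc t]
      under_class_pushforward[OF \<open>i \<in> Q\<close> desc, of 0 "\<lambda>_. 0" vertex_coords] assms(7)
    by (auto simp: cone_coords_0 cone_coords_1 mono_on_def image_subset_iff)
qed

section \<open>Homotopy colimits over a preorder\<close>

definition hocolim_rel :: "('o, 'm) small_cat \<Rightarrow> ('o, 'm, 'a) top_diagram \<Rightarrow>
    (('o \<times> 'a \<times> 'm under_pt) \<times> ('o \<times> 'a \<times> 'm under_pt)) set" where
  "hocolim_rel C D = coeq_rel (hocolim_arrows C D) (hocolim_push C D) (hocolim_pre C)"

lemma hocolim_eq_glue: "hocolim C D = glue (hocolim_objects C D) (hocolim_rel C D)"
  by (simp add: hocolim_def coequalizer_def hocolim_rel_def)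

definition hocolim_class :: "'o set \<Rightarrow> ('o \<Rightarrow> 'o \<Rightarrow> bool) \<Rightarrow> ('o, 'o \<times> 'o, 'a) top_diagram \<Rightarrow>
    'o \<Rightarrow> 'a \<Rightarrow> ('o \<times> 'o) under_pt \<Rightarrow> ('o \<times> 'a \<times> ('o \<times> 'o) under_pt) set" where
  "hocolim_class P lq D i x b = eq_closure (hocolim_rel (poset_cat P lq) D) `` {(i, x, b)}"

text \<open>The structure maps to \<open>D j\<close> agree on identified points, so all members of the class \<open>A\<close>
  have the same image and the set of images is a singleton.\<close>

definition hocolim_collapse :: "('o, 'o \<times> 'o, 'a) top_diagram \<Rightarrow> 'o \<Rightarrow>
    ('o \<times> 'a \<times> ('o \<times> 'o) under_pt) set \<Rightarrow> 'a" where
  "hocolim_collapse D j A = the_elem ((\<lambda>(i, x, b). Mp D (i, j) x) ` A)"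

text \<open>The map from \<open>D i\<close> into the homotopy colimit at the object \<open>i \<le> i\<close> of \<open>(i \<down> P)\<close>.\<close>

definition hocolim_vertex :: "'o set \<Rightarrow> ('o \<Rightarrow> 'o \<Rightarrow> bool) \<Rightarrow> ('o, 'o \<times> 'o, 'a) top_diagram \<Rightarrow>
    'o \<Rightarrow> 'a \<Rightarrow> ('o \<times> 'a \<times> ('o \<times> 'o) under_pt) set" where
  "hocolim_vertex P lq D i x =
    hocolim_class P lq D i x (under_class P lq i (\<lambda>_. i) 0 vertex_coords)"

lemma topspace_hocolim_objects:
  "topspace (hocolim_objects (poset_cat P lq) D)
    = {(i, x, b). i \<in> P \<and> x \<in> topspace (Ob D i) \<and> b \<in> topspace (under_space (poset_cat P lq) i)}"
  by (auto simp: hocolim_objects_def poset_cat_def)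

lemma topspace_hocolim_cases:
  assumes "A \<in> topspace (hocolim (poset_cat P lq) D)"
  obtains i x k p t where "i \<in> P" "x \<in> topspace (Ob D i)" "descending P lq i k p"
    "t \<in> standard_simplex k" "A = hocolim_class P lq D i x (under_class P lq i p k t)"
proof -
  obtain i x b where *: "i \<in> P" "x \<in> topspace (Ob D i)"
    "b \<in> topspace (under_space (poset_cat P lq) i)" "A = hocolim_class P lq D i x b"
    using assms unfolding hocolim_eq_glue topspace_glue topspace_hocolim_objects hocolim_class_def
    by (auto elim!: quotientE)
  from *(3) show thesis
    by (rule under_space_cases) (use * that in blast)
qed

lemma continuous_map_hocolim_component:
  assumes "i \<in> P"
  shows "continuous_map (prod_topology (Ob D i) (under_space (poset_cat P lq) i))
    (hocolim (poset_cat P lq) D) (\<lambda>(x, b). hocolim_class P lq D i x b)"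
proof -
  have "continuous_map (prod_topology (Ob D i) (under_space (poset_cat P lq) i))
      (hocolim_objects (poset_cat P lq) D) (Pair i)"
    unfolding hocolim_objects_def
    using continuous_map_component_injection[of i P
        "\<lambda>i. prod_topology (Ob D i) (under_space (poset_cat P lq) i)"] assms
    by (simp add: poset_cat_def)
  from continuous_map_compose[OF this quotient_imp_continuous_map[OF quotient_map_glue]]
  show ?thesis by (simp add: hocolim_eq_glue hocolim_class_def o_def case_prod_unfold)
qed

lemma descending_precompose:
  assumes "transp_on P lq" "i \<in> P" "j \<in> P" "lq i j" "descending P lq j k p"
  shows "descending P lq i k p"
  using assms unfolding descending_def transp_on_def by blast

lemma classifying_map_precomp:
  assumes "transp_on P lq" "i \<in> P" "j \<in> P" "lq i j"
  shows "classifying_map (under_op P lq i) (under_precomp (poset_cat P lq) (i, j)) (under_class P lq j p k t)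
    = under_class P lq i p k t"
  by (rule classifying_map_under_class)
     (use assms descending_precompose[OF assms] in \<open>auto simp: under_precomp_def poset_cat_def\<close>)

lemma hocolim_rel_cases:
  assumes "transp_on P lq" "(z, w) \<in> hocolim_rel (poset_cat P lq) D"
  obtains i j x k p t where "i \<in> P" "j \<in> P" "lq i j" "x \<in> topspace (Ob D i)"
    "descending P lq j k p" "t \<in> standard_simplex k" "z = (j, Mp D (i, j) x, under_class P lq j p k t)"
    "w = (i, x, under_class P lq i p k t)"
proof -
  let ?C = "poset_cat P lq"
  obtain i j x b where *: "i \<in> P" "j \<in> P" "lq i j" "x \<in> topspace (Ob D i)"
    "b \<in> topspace (under_space ?C j)" "z = (j, Mp D (i, j) x, b)"
    "w = (i, x, classifying_map (under_op P lq i) (under_precomp ?C (i, j)) b)"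
    using assms(2)
    by (auto simp: hocolim_rel_def coeq_rel_def hocolim_arrows_def hocolim_push_def hocolim_pre_def
        poset_cat_def)
  from *(5) obtain k p t where "descending P lq j k p" "t \<in> standard_simplex k" "b = under_class P lq j p k t"
    by (rule under_space_cases)
  then show thesis
    using that[OF *(1-4)] *(6,7) classifying_map_precomp[OF assms(1) *(1-3)] by simp
qed

text \<open>The identification in the homotopy colimit, in terms of sequences: an element can be pushed along
  \<open>i \<le> j\<close> as soon as the whole sequence lies above \<open>j\<close>.\<close>

lemma hocolim_class_push:
  assumes "transp_on P lq" "i \<in> P" "j \<in> P" "lq i j" "x \<in> topspace (Ob D i)"
    "descending P lq j k p" "t \<in> standard_simplex k"
  shows "hocolim_class P lq D j (Mp D (i, j) x) (under_class P lq j p k t)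
    = hocolim_class P lq D i x (under_class P lq i p k t)"
  unfolding hocolim_class_def
proof (rule eq_closure_class_eqI)
  let ?z = "((i, j), x, under_class P lq j p k t)"
  have "?z \<in> topspace (hocolim_arrows (poset_cat P lq) D)"
    using assms under_class_in_under_space[OF assms(3,6,7)]
    by (auto simp: hocolim_arrows_def poset_cat_def)
  moreover have "hocolim_push (poset_cat P lq) D ?z = (j, Mp D (i, j) x, under_class P lq j p k t)"
    by (simp add: hocolim_push_def poset_cat_def)
  moreover have "hocolim_pre (poset_cat P lq) ?z = (i, x, under_class P lq i p k t)"
    using classifying_map_precomp[OF assms(1-4)] by (simp add: hocolim_pre_def poset_cat_def)
  ultimately show "((j, Mp D (i, j) x, under_class P lq j p k t), i, x, under_class P lq i p k t)
      \<in> hocolim_rel (poset_cat P lq) D"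
    unfolding hocolim_rel_def coeq_rel_def by force
qed

locale preorder_diagram =
  fixes Q :: "'o set" and lq :: "'o \<Rightarrow> 'o \<Rightarrow> bool" and D :: "('o, 'o \<times> 'o, 'a) top_diagram"
  assumes reflp: "reflp_on Q lq" and transp: "transp_on Q lq"
    and top_functor: "top_functor (poset_cat Q lq) D"
begin

lemma Mp_continuous:
  "i \<in> Q \<Longrightarrow> j \<in> Q \<Longrightarrow> lq i j \<Longrightarrow> continuous_map (Ob D i) (Ob D j) (Mp D (i, j))"
  using top_functor unfolding top_functor_def by (auto simp: poset_cat_def)

lemma Mp_id: "i \<in> Q \<Longrightarrow> x \<in> topspace (Ob D i) \<Longrightarrow> Mp D (i, i) x = x"
  using top_functor unfolding top_functor_def by (auto simp: poset_cat_def)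

lemma Mp_comp:
  assumes "i \<in> Q" "j \<in> Q" "k \<in> Q" "lq i j" "lq j k" "x \<in> topspace (Ob D i)"
  shows "Mp D (j, k) (Mp D (i, j) x) = Mp D (i, k) x"
proof -
  have "\<forall>x\<in>topspace (Ob D (Src (poset_cat Q lq) (i, j))).
      Mp D (Comp (poset_cat Q lq) (j, k) (i, j)) x = Mp D (j, k) (Mp D (i, j) x)"
    using top_functor assms unfolding top_functor_def by (fastforce simp: poset_cat_def)
  then show ?thesis using assms(6) by (simp add: poset_cat_def)
qed

lemma preorder_diagram_subset:
  assumes "P \<subseteq> Q"
  shows "preorder_diagram P lq D"
proof
  show "reflp_on P lq" using reflp assms by (rule reflp_on_subset)
  show "transp_on P lq" using transp assms by (rule transp_on_subset)
  show "top_functor (poset_cat P lq) D"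
    unfolding top_functor_def
  proof (intro conjI ballI impI)
    fix f g x assume "f \<in> Arr (poset_cat P lq)" "g \<in> Arr (poset_cat P lq)"
      "Src (poset_cat P lq) g = Tgt (poset_cat P lq) f" "x \<in> topspace (Ob D (Src (poset_cat P lq) f))"
    moreover obtain i j k where "f = (i, j)" "g = (j, k)"
      using calculation by (cases f, cases g) (auto simp: poset_cat_def)
    ultimately show "Mp D (Comp (poset_cat P lq) g f) x = Mp D g (Mp D f x)"
      using Mp_comp[of i j k x, symmetric] subsetD[OF assms] by (auto simp: poset_cat_def)
  qed (use assms in \<open>auto simp: poset_cat_def intro!: Mp_continuous Mp_id\<close>)
qed

lemma descending_mono: "P \<subseteq> Q \<Longrightarrow> descending P lq i k p \<Longrightarrow> descending Q lq i k p"
  by (auto simp: descending_def)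

lemma classifying_map_id:
  assumes "P \<subseteq> Q" "i \<in> P"
  shows "classifying_map (under_op Q lq i) id (under_class P lq i p k t) = under_class Q lq i p k t"
    "continuous_map (under_space (poset_cat P lq) i) (under_space (poset_cat Q lq) i)
      (classifying_map (under_op Q lq i) id)"
  using assms descending_mono[OF assms(1)]
  by (intro classifying_map_under_class; auto)+

lemma hocolim_incl:
  assumes "P \<subseteq> Q"
  shows "i \<in> P \<Longrightarrow> hocolim_incl (poset_cat Q lq) D (hocolim_class P lq D i x (under_class P lq i p k t))
      = hocolim_class Q lq D i x (under_class Q lq i p k t)" (is "_ \<Longrightarrow> ?value")
    and "continuous_map (hocolim (poset_cat P lq) D) (hocolim (poset_cat Q lq) D)
      (hocolim_incl (poset_cat Q lq) D)" (is ?continuous)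
proof -
  let ?f = "\<lambda>(i, x, b). (i, x, classifying_map (under_op Q lq i) id b)"
  have transP: "transp_on P lq" using transp assms by (rule transp_on_subset)
  have resp: "eq_closure (hocolim_rel (poset_cat Q lq) D) `` {?f z}
      = eq_closure (hocolim_rel (poset_cat Q lq) D) `` {?f w}"
    if "(z, w) \<in> hocolim_rel (poset_cat P lq) D" for z w
    using hocolim_rel_cases[OF transP that]
  proof cases
    case (1 i j x k p t)
    then have "i \<in> Q" "j \<in> Q" using assms by auto
    from hocolim_class_push[OF transp this 1(3,4) descending_mono[OF assms 1(5)] 1(6)] show ?thesis
      using 1 by (simp add: classifying_map_id[OF assms] hocolim_class_def)
  qed
  show ?value if "i \<in> P"
    unfolding hocolim_incl_def hocolim_class_def hocolim_rel_def[symmetric]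
    by (subst glue_map_class[OF resp]) (simp_all add: classifying_map_id[OF assms that])
  have "continuous_map (hocolim_objects (poset_cat P lq) D) (hocolim_objects (poset_cat Q lq) D) ?f"
    unfolding hocolim_objects_def
  proof (rule continuous_map_sum_topology)
    fix i assume "i \<in> Obj (poset_cat P lq)"
    then have i: "i \<in> P" "i \<in> Obj (poset_cat Q lq)" using assms by (auto simp: poset_cat_def)
    have "continuous_map (prod_topology (Ob D i) (under_space (poset_cat P lq) i))
        (prod_topology (Ob D i) (under_space (poset_cat Q lq) i))
        (\<lambda>(x, b). (x, classifying_map (under_op Q lq i) id b))"
      using classifying_map_id(2)[OF assms i(1)] by (simp add: continuous_map_prod_top)
    from continuous_map_compose[OF this continuous_map_component_injection[OF i(2),
        of "\<lambda>i. prod_topology (Ob D i) (under_space (poset_cat Q lq) i)"]]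
    show "continuous_map (prod_topology (Ob D i) (under_space (poset_cat P lq) i))
      (sum_topology (\<lambda>i. prod_topology (Ob D i) (under_space (poset_cat Q lq) i)) (Obj (poset_cat Q lq)))
      (\<lambda>x. ?f (i, x))"
      by (simp add: o_def case_prod_unfold)
  qed
  from continuous_map_glue_map[OF this resp] show ?continuous
    by (simp add: hocolim_eq_glue hocolim_incl_def hocolim_rel_def)
qed

lemma hocolim_collapse:
  assumes "P \<subseteq> Q" "j \<in> Q" and bound: "\<And>i. i \<in> P \<Longrightarrow> lq i j"
  shows "i \<in> P \<Longrightarrow> hocolim_collapse D j (hocolim_class P lq D i x b) = Mp D (i, j) x" (is "_ \<Longrightarrow> ?value")
    and "continuous_map (hocolim (poset_cat P lq) D) (Ob D j) (hocolim_collapse D j)" (is ?continuous)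
proof -
  let ?f = "\<lambda>(i, x, b). Mp D (i, j) x"
  let ?r = "hocolim_rel (poset_cat P lq) D"
  have transP: "transp_on P lq" using transp assms(1) by (rule transp_on_subset)
  have resp: "?f z = ?f w" if "(z, w) \<in> ?r" for z w
    using hocolim_rel_cases[OF transP that] by cases (use assms in \<open>auto intro!: Mp_comp\<close>)
  have on_class: "hocolim_collapse D j (eq_closure ?r `` {z}) = ?f z" for z
  proof -
    have "?f ` (eq_closure ?r `` {z}) = {?f z}"
    proof -
      have "?f w = ?f z" if "(z, w) \<in> eq_closure ?r" for w
        using eq_closure_respects[of ?r ?f, OF resp that] by simp
      moreover have "(z, z) \<in> eq_closure ?r" by (simp add: eq_closure_def)
      ultimately show ?thesis by blast
    qed
    then show ?thesis by (simp add: hocolim_collapse_def)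
  qed
  show ?value by (simp add: hocolim_class_def on_class)
  have "continuous_map (hocolim_objects (poset_cat P lq) D) (Ob D j) ?f"
    unfolding hocolim_objects_def
  proof (rule continuous_map_sum_topology)
    fix i assume "i \<in> Obj (poset_cat P lq)"
    then have "i \<in> P" by (simp add: poset_cat_def)
    then have "continuous_map (Ob D i) (Ob D j) (Mp D (i, j))"
      using assms by (intro Mp_continuous) auto
    from continuous_map_compose[OF continuous_map_fst this]
    show "continuous_map (prod_topology (Ob D i) (under_space (poset_cat P lq) i)) (Ob D j) (\<lambda>x. ?f (i, x))"
      by (simp add: o_def case_prod_unfold)
  qed
  then show ?continuous
    unfolding hocolim_eq_glue
    by (intro continuous_compose_quotient_map[OF quotient_map_glue]) (simp add: o_def on_class)
qed

lemma continuous_map_hocolim_vertex: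
  assumes "i \<in> Q"
  shows "continuous_map (Ob D i) (hocolim (poset_cat Q lq) D) (hocolim_vertex Q lq D i)"
proof -
  have "descending Q lq i 0 (\<lambda>_. i)"
    using assms reflp by (simp add: descending_def reflp_on_def)
  from under_class_in_under_space[OF assms this vertex_coords_in_standard_simplex]
  have "continuous_map (Ob D i) (prod_topology (Ob D i) (under_space (poset_cat Q lq) i))
      (\<lambda>x. (x, under_class Q lq i (\<lambda>_. i) 0 vertex_coords))"
    by (simp add: continuous_map_pairwise o_def)
  from continuous_map_compose[OF this continuous_map_hocolim_component[OF assms]]
  show ?thesis by (simp add: hocolim_vertex_def[abs_def] o_def)
qed

section \<open>Contracting a homotopy colimit onto an upper bound\<close>

text \<open>The cone homotopies with apex \<open>j\<close> for the various \<open>i\<close> are compatible with precomposition and hence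
  glue. They end at the vertex \<open>i \<le> j\<close>, and the identification along \<open>i \<le> j\<close> turns this
  into the vertex \<open>j \<le> j\<close> together with the image of the point in \<open>D j\<close>.\<close>

lemma hocolim_incl_homotopic_collapse:
  assumes PQ: "P \<subseteq> Q" and j: "j \<in> Q" and bound: "\<And>i. i \<in> P \<Longrightarrow> lq i j"
  shows "homotopic_with (\<lambda>_. True) (hocolim (poset_cat P lq) D) (hocolim (poset_cat Q lq) D)
    (hocolim_incl (poset_cat Q lq) D) (hocolim_vertex Q lq D j \<circ> hocolim_collapse D j)"
proof -
  have transP: "transp_on P lq" using transp PQ by (rule transp_on_subset)
  have jj: "lq j j" using reflp j by (simp add: reflp_on_def)
  have "\<forall>i\<in>P. \<exists>H. continuous_map (prod_topology (top_of_set {0..1::real}) (under_space (poset_cat P lq) i))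
      (under_space (poset_cat Q lq) i) H \<and>
    (\<forall>s\<in>{0..1}. \<forall>k p. \<forall>t\<in>standard_simplex k. descending P lq i k p \<longrightarrow>
      H (s, under_class P lq i p k t) = under_class Q lq i (case_nat j p) (Suc k) (cone_coords s t))"
    by (intro ballI cone_homotopy PQ j jj bound)
  from bchoice[OF this] obtain K where K_all: "\<forall>i\<in>P.
    continuous_map (prod_topology (top_of_set {0..1::real}) (under_space (poset_cat P lq) i))
      (under_space (poset_cat Q lq) i) (K i) \<and>
    (\<forall>s\<in>{0..1}. \<forall>k p. \<forall>t\<in>standard_simplex k. descending P lq i k p \<longrightarrow>
      K i (s, under_class P lq i p k t) = under_class Q lq i (case_nat j p) (Suc k) (cone_coords s t))"
    by (rule exE)
  have K_cont: "continuous_map (prod_topology (top_of_set {0..1::real})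
      (under_space (poset_cat P lq) i)) (under_space (poset_cat Q lq) i) (K i)" if "i \<in> P" for i
    using bspec[OF K_all that] by (rule conjunct1)
  have K: "K i (s, under_class P lq i p k t) = under_class Q lq i (case_nat j p) (Suc k) (cone_coords s t)"
    if "i \<in> P" "s \<in> {0..1}" "t \<in> standard_simplex k" "descending P lq i k p" for i s k p t
    using conjunct2[OF bspec[OF K_all that(1)]] that(2-4) by simp
  define h where "h = (\<lambda>(s, i, x, b). hocolim_class Q lq D i x (K i (s, b)))"
  have "continuous_map (prod_topology (top_of_set {0..1}) (hocolim_objects (poset_cat P lq) D))
      (hocolim (poset_cat Q lq) D) h"
    unfolding hocolim_objects_def
  proof (rule continuous_map_prod_sum_topology)
    fix i assume "i \<in> Obj (poset_cat P lq)"
    then have i: "i \<in> P" "i \<in> Q" using PQ by (auto simp: poset_cat_def)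
    let ?X = "prod_topology (top_of_set {0..1::real}) (prod_topology (Ob D i) (under_space (poset_cat P lq) i))"
    have "continuous_map ?X (prod_topology (top_of_set {0..1}) (under_space (poset_cat P lq) i))
        (\<lambda>z. (fst z, snd (snd z)))"
      by (intro continuous_map_pairedI continuous_map_fst
          continuous_map_snd_of[OF continuous_map_snd, unfolded o_def])
    from continuous_map_compose[OF this K_cont[OF i(1)]]
    have "continuous_map ?X (prod_topology (Ob D i) (under_space (poset_cat Q lq) i))
        (\<lambda>z. (fst (snd z), K i (fst z, snd (snd z))))"
      by (intro continuous_map_pairedI continuous_map_fst_of[OF continuous_map_snd, unfolded o_def])
        (simp add: o_def)
    from continuous_map_compose[OF this continuous_map_hocolim_component[OF i(2)]]
    show "continuous_map ?X (hocolim (poset_cat Q lq) D) (\<lambda>(s, x). h (s, i, x))"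
      by (simp add: o_def h_def case_prod_unfold)
  qed
  moreover have "h (s, z) = h (s, w)" if s: "s \<in> {0..1}" and zw: "(z, w) \<in> hocolim_rel (poset_cat P lq) D" for s z w
    using hocolim_rel_cases[OF transP zw]
  proof cases
    case (1 i i' x k p t)
    have "i \<in> Q" "i' \<in> Q" using 1 PQ by auto
    have desc: "descending Q lq i' (Suc k) (case_nat j p)"
      using 1 by (intro descending_cone[OF 1(5) PQ j jj]) (auto intro: bound)
    have "descending P lq i k p"
      by (rule descending_precompose[OF transP 1(1,2,3,5)])
    then show ?thesis
      using hocolim_class_push[OF transp \<open>i \<in> Q\<close> \<open>i' \<in> Q\<close> 1(3,4) desc cone_coords_in_standard_simplex[OF s 1(6)]]
      by (simp add: h_def 1(7,8) K[OF 1(2) s 1(6,5)] K[OF 1(1) s 1(6)])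
  qed
  ultimately have "\<exists>H. continuous_map (prod_topology (top_of_set {0..1}) (hocolim (poset_cat P lq) D))
      (hocolim (poset_cat Q lq) D) H \<and>
      (\<forall>s\<in>{0..1}. \<forall>z\<in>topspace (hocolim_objects (poset_cat P lq) D).
        H (s, eq_closure (hocolim_rel (poset_cat P lq) D) `` {z}) = h (s, z))"
    unfolding hocolim_eq_glue[of "poset_cat P lq"] by (rule glue_homotopy)
  then obtain H where H_cont: "continuous_map (prod_topology (top_of_set {0..1}) (hocolim (poset_cat P lq) D))
      (hocolim (poset_cat Q lq) D) H"
    and H: "\<And>s z. s \<in> {0..1} \<Longrightarrow> z \<in> topspace (hocolim_objects (poset_cat P lq) D) \<Longrightarrow>
        H (s, eq_closure (hocolim_rel (poset_cat P lq) D) `` {z}) = h (s, z)"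
    by blast
  have H01: "H (0, A) = hocolim_incl (poset_cat Q lq) D A \<and>
      H (1, A) = (hocolim_vertex Q lq D j \<circ> hocolim_collapse D j) A"
    if "A \<in> topspace (hocolim (poset_cat P lq) D)" for A
    using that
  proof (cases rule: topspace_hocolim_cases)
    case (1 i x k p t)
    have iQ: "i \<in> Q" using 1 PQ by auto
    have "(i, x, under_class P lq i p k t) \<in> topspace (hocolim_objects (poset_cat P lq) D)"
      using 1 under_class_in_under_space[OF 1(1,3,4)] by (simp add: topspace_hocolim_objects)
    from H[OF _ this] have Hs: "H (s, A) = hocolim_class Q lq D i x
        (under_class Q lq i (case_nat j p) (Suc k) (cone_coords s t))" if "s \<in> {0..1}" for s
      using that by (simp add: 1(5) hocolim_class_def[of P] h_def K[OF 1(1) _ 1(4,3)])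
    note ends = cone_homotopy_ends[where lq = lq, OF PQ 1(1) j jj bound 1(3,4)]
    have "H (0, A) = hocolim_incl (poset_cat Q lq) D A"
      using Hs[of 0] by (simp add: ends(1) 1(5) hocolim_incl(1)[OF PQ 1(1)])
    moreover have "descending Q lq j 0 (\<lambda>_. j)"
      using j jj by (simp add: descending_def)
    from hocolim_class_push[OF transp iQ j bound[OF 1(1)] 1(2) this vertex_coords_in_standard_simplex]
    have "H (1, A) = hocolim_vertex Q lq D j (Mp D (i, j) x)"
      using Hs[of 1] by (simp add: ends(2) hocolim_vertex_def)
    ultimately show ?thesis
      by (simp add: 1(5) hocolim_collapse(1)[OF PQ j bound 1(1)])
  qed
  show ?thesis
    by (subst homotopic_with) (use H_cont H01 in \<open>auto intro!: exI[of _ H]\<close>)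
qed

text \<open>This is the previous homotopy for the one-element preorder \<open>{i}\<close> and its upper bound \<open>j\<close>, restricted
  to the vertex at \<open>i\<close>.\<close>

lemma hocolim_vertex_homotopic:
  assumes i: "i \<in> Q" and j: "j \<in> Q" and ij: "lq i j"
  shows "homotopic_with (\<lambda>_. True) (Ob D i) (hocolim (poset_cat Q lq) D)
    (hocolim_vertex Q lq D i) (hocolim_vertex Q lq D j \<circ> Mp D (i, j))"
proof -
  interpret P: preorder_diagram "{i}" lq D
    using i by (intro preorder_diagram_subset) simp
  have PQ: "{i} \<subseteq> Q" and bound: "\<And>i'. i' \<in> {i} \<Longrightarrow> lq i' j" using i ij by auto
  have "homotopic_with (\<lambda>_. True) (Ob D i) (hocolim (poset_cat Q lq) D)
    (hocolim_incl (poset_cat Q lq) D \<circ> hocolim_vertex {i} lq D i)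
    ((hocolim_vertex Q lq D j \<circ> hocolim_collapse D j) \<circ> hocolim_vertex {i} lq D i)"
    by (rule homotopic_with_compose_continuous_map_right[OF
          hocolim_incl_homotopic_collapse[OF PQ j bound] P.continuous_map_hocolim_vertex]) auto
  moreover have "hocolim_incl (poset_cat Q lq) D \<circ> hocolim_vertex {i} lq D i = hocolim_vertex Q lq D i"
    by (simp add: fun_eq_iff hocolim_vertex_def hocolim_incl(1)[OF PQ])
  moreover have "(hocolim_vertex Q lq D j \<circ> hocolim_collapse D j) \<circ> hocolim_vertex {i} lq D i
      = hocolim_vertex Q lq D j \<circ> Mp D (i, j)"
    using hocolim_collapse(1)[OF PQ j bound] by (simp add: fun_eq_iff hocolim_vertex_def)
  ultimately show ?thesis by simp
qed

end

section \<open>The product and the generalized tensor product\<close>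

definition quadrant :: "(real \<times> real) set" where
  "quadrant = {0<..} \<times> {0<..}"

definition triangle :: "real \<Rightarrow> (real \<times> real) set" where
  "triangle r = {(i, j). 0 < i \<and> 0 < j \<and> i + j \<le> r}"

abbreviation coord_le :: "real \<times> real \<Rightarrow> real \<times> real \<Rightarrow> bool" where
  "coord_le p q \<equiv> fst p \<le> fst q \<and> snd p \<le> snd q"

lemma triangle_cat_eq: "triangle_cat r = poset_cat (triangle r) coord_le"
  by (simp add: triangle_cat_def triangle_def)

lemma triangle_mono: "r \<le> r' \<Longrightarrow> triangle r \<subseteq> triangle r'"
  by (auto simp: triangle_def)

lemma triangle_subset_quadrant: "triangle r \<subseteq> quadrant"
  by (auto simp: triangle_def quadrant_def)

lemma box_product_preorder_diagram:
  assumes X: "top_functor Rpos_cat X" and Y: "top_functor Rpos_cat Y"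
  shows "preorder_diagram quadrant coord_le (box_product X Y)"
proof
  have pX: "preorder_diagram {0<..} (\<le>) X" and pY: "preorder_diagram {0<..} (\<le>) Y"
    using X Y by (auto intro!: preorder_diagram.intro simp: reflp_on_def transp_on_def)
  interpret X: preorder_diagram "{0<..}" "(\<le>)" X by (rule pX)
  interpret Y: preorder_diagram "{0<..}" "(\<le>)" Y by (rule pY)
  show "reflp_on quadrant coord_le" by (simp add: reflp_on_def)
  show "transp_on quadrant coord_le" by (auto simp: transp_on_def)
  show "top_functor (poset_cat quadrant coord_le) (box_product X Y)"
    unfolding top_functor_def
  proof (intro conjI ballI impI)
    fix u assume "u \<in> Arr (poset_cat quadrant coord_le)"
    then obtain i j i' j' where u: "u = ((i, j), (i', j'))"
      "0 < i" "0 < j" "0 < i'" "0 < j'" "i \<le> i'" "j \<le> j'"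
      by (auto simp: poset_cat_def quadrant_def)
    then show "continuous_map (Ob (box_product X Y) (Src (poset_cat quadrant coord_le) u))
        (Ob (box_product X Y) (Tgt (poset_cat quadrant coord_le) u)) (Mp (box_product X Y) u)"
      using X.Mp_continuous[of i i'] Y.Mp_continuous[of j j']
      by (simp add: box_product_def poset_cat_def map_prod_def continuous_map_prod_top)
  next
    fix p z assume "p \<in> Obj (poset_cat quadrant coord_le)" "z \<in> topspace (Ob (box_product X Y) p)"
    then show "Mp (box_product X Y) (Idt (poset_cat quadrant coord_le) p) z = z"
      by (auto simp: box_product_def poset_cat_def quadrant_def X.Mp_id Y.Mp_id)
  next
    fix f g z assume fg: "f \<in> Arr (poset_cat quadrant coord_le)" "g \<in> Arr (poset_cat quadrant coord_le)"
      "Src (poset_cat quadrant coord_le) g = Tgt (poset_cat quadrant coord_le) f"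
      "z \<in> topspace (Ob (box_product X Y) (Src (poset_cat quadrant coord_le) f))"
    obtain i j i' j' i'' j'' x y where "f = ((i, j), (i', j'))" "g = ((i', j'), (i'', j''))" "z = (x, y)"
      using fg by (cases f, cases g, cases z) (auto simp: poset_cat_def)
    then show "Mp (box_product X Y) (Comp (poset_cat quadrant coord_le) g f) z
        = Mp (box_product X Y) g (Mp (box_product X Y) f z)"
      using fg X.Mp_comp[of i i' i'' x] Y.Mp_comp[of j j' j'' y]
      by (simp add: box_product_def poset_cat_def quadrant_def)
  qed
qed

theorem theorem3p20:
  fixes n :: nat
    and X :: "'a persistent_space"
    and Y :: "'b persistent_space"
  assumes "top_functor Rpos_cat X"
    and "top_functor Rpos_cat Y"
  shows "interleaving_distance
      (persistent_homology n (ln_functor (cat_product X Y)) TYPE('f::field))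
      (persistent_homology n (ln_functor (gen_tensor X Y)) TYPE('f))
    \<le> ereal (ln 2)"
proof -
  let ?Z = "ln_functor (cat_product X Y)" and ?W = "ln_functor (gen_tensor X Y)"
  let ?B = "box_product X Y"
  define \<delta> :: real where "\<delta> = ln 2"
  define d where "d = (\<lambda>r. (exp r, exp r) :: real \<times> real)"
  define T where "T = (\<lambda>r. triangle (exp r))"
  interpret box: preorder_diagram quadrant coord_le ?B
    by (rule box_product_preorder_diagram[OF assms])
  have box_T: "preorder_diagram (T r) coord_le ?B" for r
    unfolding T_def by (rule box.preorder_diagram_subset[OF triangle_subset_quadrant])
  have exp_\<delta>: "exp (r + \<delta>) = 2 * exp r" for r by (simp add: \<delta>_def exp_add)
  have Z_Ob: "Ob ?Z r = Ob ?B (d r)" for r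
    by (simp add: ln_functor_def cat_product_def box_product_def d_def)
  have Z_Mp: "Mp ?Z (r, r') = Mp ?B (d r, d r')" for r r'
    by (simp add: ln_functor_def cat_product_def box_product_def d_def)
  have W_Ob: "Ob ?W r = hocolim (poset_cat (T r) coord_le) ?B" for r
    by (simp add: ln_functor_def gen_tensor_def triangle_cat_eq T_def)
  have W_Mp: "Mp ?W (r, r') = hocolim_incl (poset_cat (T r') coord_le) ?B" for r r'
    by (simp add: ln_functor_def gen_tensor_def triangle_cat_eq T_def)
  have d_quadrant: "d r \<in> quadrant" for r by (simp add: d_def quadrant_def)
  have d_mono: "coord_le (d r) (d r')" if "r \<le> r'" for r r' using that by (simp add: d_def)
  \<comment> \<open>Here the constant \<open>ln 2\<close> enters: \<open>(s, s)\<close> lies in the triangle of size \<open>2 s\<close>.\<close>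
  have d_T: "d r \<in> T r'" if "r + \<delta> \<le> r'" for r r'
  proof -
    have "exp r + exp r \<le> exp r'" using exp_\<delta>[of r] that by (metis exp_le_cancel_iff mult_2)
    then show ?thesis by (simp add: d_def T_def triangle_def)
  qed
  have T_mono: "T r \<subseteq> T r'" if "r \<le> r'" for r r'
    using that by (simp add: T_def triangle_mono)
  have T_quadrant: "T r \<subseteq> quadrant" for r by (simp add: T_def triangle_subset_quadrant)
  have T_bound: "coord_le p (d r')" if "r \<le> r'" "p \<in> T r" for r r' p
  proof -
    have "exp r \<le> exp r'" using that by simp
    then show ?thesis
      using that(2) by (cases p) (simp add: T_def d_def triangle_def del: exp_le_cancel_iff)
  qed
  have \<delta>: "0 \<le> \<delta>" by (simp add: \<delta>_def)
  let ?f = "\<lambda>r. hocolim_vertex (T (r + \<delta>)) coord_le ?B (d r)"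
  let ?g = "\<lambda>r. hocolim_collapse ?B (d (r + \<delta>))"
  have g_value: "?g r (hocolim_class (T r') coord_le ?B i x b) = Mp ?B (i, d (r + \<delta>)) x"
    if "r' \<le> r + \<delta>" "i \<in> T r'" for r r' i x b
    by (rule box.hocolim_collapse(1)[OF T_quadrant d_quadrant T_bound that(2)]) (use that in auto)
  have f_cont: "continuous_map (Ob ?Z r) (Ob ?W (r + \<delta>)) (?f r)" for r
    unfolding Z_Ob W_Ob
    by (rule preorder_diagram.continuous_map_hocolim_vertex[OF box_T d_T]) simp
  have g_cont: "continuous_map (Ob ?W r) (Ob ?Z (r + \<delta>)) (?g r)" for r
    unfolding Z_Ob W_Ob
    by (rule box.hocolim_collapse(2)[OF T_quadrant d_quadrant T_bound]) (use \<delta> in auto)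
  have Z_cont: "continuous_map (Ob ?Z r) (Ob ?Z r') (Mp ?Z (r, r'))" if "r \<le> r'" for r r'
    unfolding Z_Ob Z_Mp using that by (intro box.Mp_continuous d_quadrant d_mono)
  have W_cont: "continuous_map (Ob ?W r) (Ob ?W r') (Mp ?W (r, r'))" if "r \<le> r'" for r r'
    unfolding W_Ob W_Mp by (rule preorder_diagram.hocolim_incl(2)[OF box_T T_mono[OF that]])
  have "interleaving_distance (persistent_homology n ?Z TYPE('f)) (persistent_homology n ?W TYPE('f))
    \<le> ereal \<delta>"
  proof (rule homotopy_interleaving_distance[OF \<delta> Z_cont W_cont f_cont g_cont])
    fix r r' :: real assume rr': "r \<le> r'"
    \<comment> \<open>Naturality of the vertex maps holds up to moving from the vertex at \<open>d r\<close> to the one at \<open>d r'\<close>.\<close>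
    have incl: "T (r + \<delta>) \<subseteq> T (r' + \<delta>)" and dr: "d r \<in> T (r + \<delta>)" "d r \<in> T (r' + \<delta>)" "d r' \<in> T (r' + \<delta>)"
      using rr' T_mono[of "r + \<delta>" "r' + \<delta>"] by (simp_all add: d_T)
    have "Mp ?W (r + \<delta>, r' + \<delta>) \<circ> ?f r = hocolim_vertex (T (r' + \<delta>)) coord_le ?B (d r)"
      unfolding W_Mp
      by (simp add: fun_eq_iff hocolim_vertex_def preorder_diagram.hocolim_incl(1)[OF box_T incl dr(1)])
    then show "homotopic_with (\<lambda>_. True) (Ob ?Z r) (Ob ?W (r' + \<delta>))
        (?f r' \<circ> Mp ?Z (r, r')) (Mp ?W (r + \<delta>, r' + \<delta>) \<circ> ?f r)"
      unfolding Z_Ob Z_Mp W_Ob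
      using preorder_diagram.hocolim_vertex_homotopic[OF box_T dr(2,3) d_mono[OF rr']]
      by (simp add: homotopic_with_sym)
    show "homotopic_with (\<lambda>_. True) (Ob ?W r) (Ob ?Z (r' + \<delta>))
        (?g r' \<circ> Mp ?W (r, r')) (Mp ?Z (r + \<delta>, r' + \<delta>) \<circ> ?g r)"
    proof (rule homotopic_with_equal)
      show "continuous_map (Ob ?W r) (Ob ?Z (r' + \<delta>)) (?g r' \<circ> Mp ?W (r, r'))"
        by (rule continuous_map_compose[OF W_cont[OF rr'] g_cont])
      fix A assume "A \<in> topspace (Ob ?W r)"
      then show "(?g r' \<circ> Mp ?W (r, r')) A = (Mp ?Z (r + \<delta>, r' + \<delta>) \<circ> ?g r) A"
        unfolding W_Ob
      proof (cases rule: topspace_hocolim_cases)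
        case (1 i x k p t)
        have "i \<in> T r'" "i \<in> quadrant" "coord_le i (d (r + \<delta>))"
          using 1(1) T_mono[OF rr'] T_quadrant T_bound[of r "r + \<delta>" i] \<delta> by auto
        moreover have "Mp ?W (r, r') A = hocolim_class (T r') coord_le ?B i x (under_class (T r') coord_le i p k t)"
          unfolding W_Mp 1(5) by (rule preorder_diagram.hocolim_incl(1)[OF box_T T_mono[OF rr'] 1(1)])
        moreover have "Mp ?B (d (r + \<delta>), d (r' + \<delta>)) (Mp ?B (i, d (r + \<delta>)) x) = Mp ?B (i, d (r' + \<delta>)) x"
          using calculation rr' 1(2) d_mono[of "r + \<delta>" "r' + \<delta>"]
          by (intro box.Mp_comp d_quadrant) auto
        ultimately show ?thesis
          using \<delta> 1(1) by (simp add: g_value Z_Mp 1(5))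
      qed
    qed simp_all
  next
    fix r :: real
    have \<delta>2: "r + \<delta> + \<delta> = r + 2 * \<delta>" by simp
    \<comment> \<open>The point \<open>d (r + \<delta>)\<close> bounds the triangle at \<open>r\<close> and lies in the triangle at \<open>r + 2 \<delta>\<close>.\<close>
    show "homotopic_with (\<lambda>_. True) (Ob ?W r) (Ob ?W (r + 2 * \<delta>)) (?f (r + \<delta>) \<circ> ?g r) (Mp ?W (r, r + 2 * \<delta>))"
      unfolding W_Ob W_Mp \<delta>2
      by (subst homotopic_with_sym,
          rule preorder_diagram.hocolim_incl_homotopic_collapse[OF box_T T_mono d_T T_bound])
         (use \<delta> in auto)
    have "(?g (r + \<delta>) \<circ> ?f r) x = Mp ?Z (r, r + 2 * \<delta>) x" for x
      using g_value[of "r + \<delta>" "r + \<delta>" "d r"] \<delta> d_T[of r "r + \<delta>"]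
      by (simp add: hocolim_vertex_def Z_Mp \<delta>2)
    then have "?g (r + \<delta>) \<circ> ?f r = Mp ?Z (r, r + 2 * \<delta>)" by (rule ext)
    then show "homotopic_with (\<lambda>_. True) (Ob ?Z r) (Ob ?Z (r + 2 * \<delta>)) (?g (r + \<delta>) \<circ> ?f r) (Mp ?Z (r, r + 2 * \<delta>))"
      using Z_cont[of r "r + 2 * \<delta>"] \<delta> by simp
  qed
  then show ?thesis by (simp add: \<delta>_def)
qed

end
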